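(* Consider a one-body quantum flow determined by $(\rho,S)$, with $\rho_m,P,\mathbf u,\mathbf v,E,\Psi,\hat H$ as in the context, and a real potential $U$. 1) The energy equation $$E\rho=\tfrac12\rho_m|\mathbf u|^2+\tfrac12\rho_m|\mathbf v|^2+P+U\rho$$ is equivalent to the Euler equation $$\rho_m\partial\mathbf v+\tfrac12\rho_m\nabla\big(|\mathbf u|^2+|\mathbf v|^2\big)+\nabla P+\big(\nabla\cdot(\rho_m\mathbf u)\big)\mathbf u+\rho\nabla U=\mathbf 0 .$$ 2) This Euler equation is equivalent to the real part of the Schr\"odinger equation, $\mathrm{Re}(i\hbar\Psi^*\partial\Psi)=\mathrm{Re}(\Psi^*\hat H\Psi)$.
   Context: Constants $\hbar,m>0$. $\partial=\partial/\partial t$ and $\nabla$ is the gradient in $\mathbf r\in\mathbb R^3$. $\rho\ge0$ and $S$ are real functions on $\mathbb R\times\mathbb R^3$ (time and space), twice continuously differentiable almost everywhere (a spin variable, if present, is a fixed parameter); the zero set of $\rho$ has measure zero for each time; $\Psi=\sqrt\rho\,e^{iS/\hbar}$, where $\Psi$ is defined to within a phase factor and $\int\rho=1$. All equalities are understood almost everywhere, and two equations are equivalent if a function satisfies one almost everywhere if and only if it satisfies the other almost everywhere. Definitions: $\zeta_0=\hbar/2$, $\zeta=\zeta_0/m$, $\rho_m=m\rho$; $\mathbf v=\frac1m\nabla S$, $\mathbf u=-\zeta\,\nabla\rho/\rho$; $P=\zeta_0\nabla\cdot(\rho\mathbf u)=-\zeta\zeta_0\nabla^2\rho$; $E=-\partial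 S$; $\hat H=-\frac{\hbar^2}{2m}\nabla^2+U$. The one-body quantum flow is the collection $(P,\rho_m,\mathbf u,\mathbf v)$ so determined by $(\rho,S)$.
   Formalization: From Euler, the energy and Schrödinger equations follow for S+θ(t), with θ chosen on each open regular region where ρ≠0 with connected constant-time sections (for S itself this is false); P and U are assumed continuous with continuous spatial gradients on an open set of full measure. *)

theory Defs
  imports "HOL-Analysis.Analysis"
begin

text \<open>Functions of time and position; \<open>f t r\<close> is the value at time \<open>t\<close> and position \<open>r\<close>.\<close>

type_synonym 'a field = "real \<Rightarrow> real^3 \<Rightarrow> 'a"


section \<open>Differential operators\<close>

definition dt :: "'a::real_normed_vector field \<Rightarrow> 'a field" where
  "dt f t r = vector_derivative (\<lambda>s. f s r) (at t)"

definition grad :: "(real^3 \<Rightarrow> real) \<Rightarrow> real^3 \<Rightarrow> real^3" where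
  "grad f r = (THE D. GDERIV f r :> D)"

definition divergence :: "(real^3 \<Rightarrow> real^3) \<Rightarrow> real^3 \<Rightarrow> real" where
  "divergence F r = trace (jacobian F (at r))"

definition partial_deriv :: "3 \<Rightarrow> (real^3 \<Rightarrow> 'a::real_normed_vector) \<Rightarrow> real^3 \<Rightarrow> 'a" where
  "partial_deriv i f r = frechet_derivative f (at r) (axis i 1)"

definition laplacian :: "(real^3 \<Rightarrow> 'a::real_normed_vector) \<Rightarrow> real^3 \<Rightarrow> 'a" where
  "laplacian f r = (\<Sum>i\<in>UNIV. partial_deriv i (partial_deriv i f) r)"


section \<open>The one-body quantum flow of a pair of a density and a phase\<close>

definition zeta0 :: "real \<Rightarrow> real" where
  "zeta0 hbar = hbar / 2"

definition zeta :: "real \<Rightarrow> real \<Rightarrow> real" where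
  "zeta hbar m = zeta0 hbar / m"

definition mass_density :: "real \<Rightarrow> real field \<Rightarrow> real field" where
  "mass_density m \<rho> t r = m * \<rho> t r"

definition vel_v :: "real \<Rightarrow> real field \<Rightarrow> (real^3) field" where
  "vel_v m S t r = (1 / m) *\<^sub>R grad (S t) r"

definition vel_u :: "real \<Rightarrow> real \<Rightarrow> real field \<Rightarrow> (real^3) field" where
  "vel_u hbar m \<rho> t r = - (zeta hbar m / \<rho> t r) *\<^sub>R grad (\<rho> t) r"

definition pressure :: "real \<Rightarrow> real \<Rightarrow> real field \<Rightarrow> real field" where
  "pressure hbar m \<rho> t r = zeta0 hbar * divergence (\<lambda>x. \<rho> t x *\<^sub>R vel_u hbar m \<rho> t x) r"

definition energy :: "real field \<Rightarrow> real field" where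
  "energy S t r = - dt S t r"

definition wave_function :: "real \<Rightarrow> real field \<Rightarrow> real field \<Rightarrow> complex field" where
  "wave_function hbar \<rho> S t r = of_real (sqrt (\<rho> t r)) * exp (\<i> * of_real (S t r / hbar))"

definition hamiltonian :: "real \<Rightarrow> real \<Rightarrow> real field \<Rightarrow> complex field \<Rightarrow> complex field" where
  "hamiltonian hbar m U \<psi> t r =
     - of_real (hbar\<^sup>2 / (2 * m)) * laplacian (\<psi> t) r + of_real (U t r) * \<psi> t r"


section \<open>The three equations at a point of space-time\<close>

definition energy_equation ::
  "real \<Rightarrow> real \<Rightarrow> real field \<Rightarrow> real field \<Rightarrow> real field \<Rightarrow> real \<Rightarrow> real^3 \<Rightarrow> bool" where
  "energy_equation hbar m U \<rho> S t r \<longleftrightarrow>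
     energy S t r * \<rho> t r =
       1/2 * mass_density m \<rho> t r * (norm (vel_u hbar m \<rho> t r))\<^sup>2
       + 1/2 * mass_density m \<rho> t r * (norm (vel_v m S t r))\<^sup>2
       + pressure hbar m \<rho> t r + U t r * \<rho> t r"

definition euler_equation ::
  "real \<Rightarrow> real \<Rightarrow> real field \<Rightarrow> real field \<Rightarrow> real field \<Rightarrow> real \<Rightarrow> real^3 \<Rightarrow> bool" where
  "euler_equation hbar m U \<rho> S t r \<longleftrightarrow>
     mass_density m \<rho> t r *\<^sub>R dt (vel_v m S) t r
     + (1/2 * mass_density m \<rho> t r) *\<^sub>R
         grad (\<lambda>x. (norm (vel_u hbar m \<rho> t x))\<^sup>2 + (norm (vel_v m S t x))\<^sup>2) r
     + grad (pressure hbar m \<rho> t) r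
     + divergence (\<lambda>x. mass_density m \<rho> t x *\<^sub>R vel_u hbar m \<rho> t x) r *\<^sub>R vel_u hbar m \<rho> t r
     + \<rho> t r *\<^sub>R grad (U t) r = 0"

definition re_schroedinger_equation ::
  "real \<Rightarrow> real \<Rightarrow> real field \<Rightarrow> real field \<Rightarrow> real field \<Rightarrow> real \<Rightarrow> real^3 \<Rightarrow> bool" where
  "re_schroedinger_equation hbar m U \<rho> S t r \<longleftrightarrow>
     (let \<Psi> = wave_function hbar \<rho> S in
       Re (\<i> * of_real hbar * cnj (\<Psi> t r) * dt \<Psi> t r) =
       Re (cnj (\<Psi> t r) * hamiltonian hbar m U \<Psi> t r))"

definition holds_ae :: "(real \<Rightarrow> real^3 \<Rightarrow> bool) \<Rightarrow> bool" where
  "holds_ae eqn \<longleftrightarrow> (AE (t, r) in lborel. eqn t r)"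


section \<open>Regularity\<close>

definition C1_on :: "'a::real_normed_vector set \<Rightarrow> ('a \<Rightarrow> 'b::real_normed_vector) \<Rightarrow> bool" where
  "C1_on W f \<longleftrightarrow>
     (\<exists>f' :: 'a \<Rightarrow> 'a \<Rightarrow>\<^sub>L 'b. (\<forall>z\<in>W. (f has_derivative blinfun_apply (f' z)) (at z)) \<and> continuous_on W f')"

definition C2_on :: "'a::real_normed_vector set \<Rightarrow> ('a \<Rightarrow> 'b::real_normed_vector) \<Rightarrow> bool" where
  "C2_on W f \<longleftrightarrow>
     (\<exists>f' :: 'a \<Rightarrow> 'a \<Rightarrow>\<^sub>L 'b. (\<forall>z\<in>W. (f has_derivative blinfun_apply (f' z)) (at z)) \<and> C1_on W f')"

definition space_C1_on :: "(real \<times> (real^3)) set \<Rightarrow> real field \<Rightarrow> bool" where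
  "space_C1_on W f \<longleftrightarrow>
     continuous_on W (\<lambda>(t, r). f t r) \<and>
     (\<exists>g. (\<forall>(t, r)\<in>W. GDERIV (f t) r :> g (t, r)) \<and> continuous_on W g)"

text \<open>The gradients of \<open>P\<close> and \<open>U\<close> occur in the Euler equation, but \<open>P\<close> contains the second
  derivatives of \<open>\<rho>\<close>; so their existence and continuity is not a consequence of \<open>\<rho>\<close> and \<open>S\<close> being
  twice continuously differentiable.\<close>

definition regular_on ::
  "real \<Rightarrow> real \<Rightarrow> real field \<Rightarrow> real field \<Rightarrow> real field \<Rightarrow> (real \<times> (real^3)) set \<Rightarrow> bool" where
  "regular_on hbar m U \<rho> S W \<longleftrightarrow>
     open W \<and> C2_on W (\<lambda>(t, r). \<rho> t r) \<and> C2_on W (\<lambda>(t, r). S t r) \<and>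
     space_C1_on W (pressure hbar m \<rho>) \<and> space_C1_on W U"


section \<open>Equations for a wave function that is defined to within a phase factor\<close>

text \<open>Replacing \<open>S t r\<close> by \<open>S t r + \<theta> t\<close> multiplies the wave function by the phase factor
  \<open>exp (\<i> \<theta> t / \<hbar>)\<close> and leaves \<open>P\<close>, \<open>\<rho>\<^sub>m\<close>, \<open>u\<close>, \<open>v\<close> unchanged, but subtracts \<open>\<theta>' t\<close> from \<open>E\<close>.
  The Euler equation is invariant under this change and the energy equation is not, so
  the latter can be recovered from the former only for a suitable choice of the phase factor.

  The phase of the wave function on different components of the set where it is regular and
  nonzero (separated by nodal surfaces, for example) can be chosen independently. Hence a phase
  factor \<open>\<theta>\<close> that depends on time only is required on every part \<open>W\<close> of this set with connected
  sections at constant time. If the whole set has connected sections, it is itself such a \<open>W\<close>, and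
  one \<open>\<theta>\<close> serves almost everywhere.\<close>

definition phase_region ::
  "real \<Rightarrow> real \<Rightarrow> real field \<Rightarrow> real field \<Rightarrow> real field \<Rightarrow> (real \<times> (real^3)) set \<Rightarrow> bool" where
  "phase_region hbar m U \<rho> S W \<longleftrightarrow>
     regular_on hbar m U \<rho> S W \<and> (\<forall>(t, r)\<in>W. \<rho> t r \<noteq> 0) \<and> (\<forall>t. connected {r. (t, r) \<in> W})"

definition holds_ae_within_phase ::
  "real \<Rightarrow> real \<Rightarrow> real field \<Rightarrow> real field \<Rightarrow> real field \<Rightarrow>
    (real field \<Rightarrow> real \<Rightarrow> real^3 \<Rightarrow> bool) \<Rightarrow> bool" where
  "holds_ae_within_phase hbar m U \<rho> S eqn \<longleftrightarrow>
     (\<forall>W. phase_region hbar m U \<rho> S W \<longrightarrow>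
       (\<exists>\<theta> :: real \<Rightarrow> real. \<theta> C1_differentiable_on (fst ` W) \<and>
         holds_ae (\<lambda>t r. (t, r) \<in> W \<longrightarrow> eqn (\<lambda>t r. S t r + \<theta> t) t r)))"

end

theory Submission
  imports Defs
begin

text \<open>Where \<open>\<rho> \<noteq> 0\<close>, divide the energy equation by \<open>\<rho>\<close> and let
  \<open>R = E - m/2 (|u|\<^sup>2 + |v|\<^sup>2) - P/\<rho> - U\<close>. Since \<open>\<nabla>\<cdot>(\<rho>\<^sub>m u) u = - (P/\<rho>) \<nabla>\<rho>\<close> and time and space
  derivatives of \<open>S\<close> commute, the left-hand side of the Euler equation is \<open>- \<rho> \<nabla>R\<close>. By continuity
  each equation holds almost everywhere on an open set iff it holds everywhere there. So the Euler
  equation says that \<open>R\<close> depends on time only on regions with connected sections; replacing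
  \<open>S\<close> by \<open>S + \<theta>\<close> changes \<open>R\<close> to \<open>R - \<theta>'\<close>, and an antiderivative of \<open>R\<close> is the required phase.
  Finally, \<open>Re (\<Psi>\<^sup>* \<Delta>\<Psi>) = \<Delta>\<rho>/2 - |\<nabla>\<rho>|\<^sup>2/(4\<rho>) - \<rho> |\<nabla>S|\<^sup>2/\<hbar>\<^sup>2\<close>
  makes the real part of the Schroedinger equation the energy equation, pointwise.\<close>

section \<open>Symmetry of the second derivative\<close>

lemma has_derivative_along_line:
  assumes "(f has_derivative D) (at (z + s *\<^sub>R u))"
  shows "((\<lambda>s. f (z + s *\<^sub>R u)) has_vector_derivative D u) (at s within T)"
proof -
  have "((\<lambda>s. z + s *\<^sub>R u) has_derivative (\<lambda>h. h *\<^sub>R u)) (at s within T)"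
    by (auto intro!: derivative_eq_intros)
  then have "((\<lambda>s. f (z + s *\<^sub>R u)) has_derivative (\<lambda>h. D (h *\<^sub>R u))) (at s within T)"
    using assms by (rule has_derivative_compose)
  moreover have "linear D" using assms by (rule has_derivative_linear)
  ultimately show ?thesis
    by (simp add: has_vector_derivative_def linear_scale)
qed

text \<open>The mean value theorem is applied twice: in direction \<open>v\<close> to the increment
  of \<open>f\<close> over \<open>h *\<^sub>R u\<close>, then in direction \<open>u\<close> to the
  derivative of \<open>f\<close> along \<open>v\<close>. Real values of \<open>f\<close> give an
  exact equality instead of an estimate, and this nesting fixes the argument order
  \<open>u v\<close> of \<open>f''\<close>.\<close>

lemma second_difference_mean_value:
  fixes f :: "'a::real_normed_vector \<Rightarrow> real"
  assumes "h > 0"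
    and W: "\<And>a b. 0 \<le> a \<Longrightarrow> a \<le> h \<Longrightarrow> 0 \<le> b \<Longrightarrow> b \<le> h \<Longrightarrow> z + a *\<^sub>R u + b *\<^sub>R v \<in> W"
    and f': "\<And>w. w \<in> W \<Longrightarrow> (f has_derivative blinfun_apply (f' w)) (at w)"
    and f'': "\<And>w. w \<in> W \<Longrightarrow> (f' has_derivative blinfun_apply (f'' w)) (at w)"
  obtains a b where "0 < a" "a < h" "0 < b" "b < h"
    "f (z + h *\<^sub>R u + h *\<^sub>R v) - f (z + h *\<^sub>R u) - f (z + h *\<^sub>R v) + f z
       = h * (h * f'' (z + a *\<^sub>R u + b *\<^sub>R v) u v)"
proof -
  define p where "p b = f (z + h *\<^sub>R u + b *\<^sub>R v) - f (z + b *\<^sub>R v)" for b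
  have "\<exists>b\<in>{0<..<h}. p h - p 0
      = (\<lambda>y. y *\<^sub>R (f' (z + h *\<^sub>R u + b *\<^sub>R v) v - f' (z + b *\<^sub>R v) v)) (h - 0)"
  proof (rule mvt_simple[OF \<open>h > 0\<close>])
    fix b assume b: "0 \<le> b" "b \<le> h"
    have "z + h *\<^sub>R u + b *\<^sub>R v \<in> W" "z + b *\<^sub>R v \<in> W"
      using W[of h b] W[of 0 b] b \<open>h > 0\<close> by auto
    then show "(p has_derivative (\<lambda>y. y *\<^sub>R (f' (z + h *\<^sub>R u + b *\<^sub>R v) v - f' (z + b *\<^sub>R v) v)))
        (at b within {0..h})"
      unfolding p_def has_vector_derivative_def[symmetric]
      by (intro has_vector_derivative_diff has_derivative_along_line f')
  qed
  then obtain b where b: "0 < b" "b < h"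
    "p h - p 0 = h * (f' (z + h *\<^sub>R u + b *\<^sub>R v) v - f' (z + b *\<^sub>R v) v)" by auto
  define q where "q a = f' ((z + b *\<^sub>R v) + a *\<^sub>R u) v" for a
  have "\<exists>a\<in>{0<..<h}. q h - q 0 = (\<lambda>y. y *\<^sub>R f'' ((z + b *\<^sub>R v) + a *\<^sub>R u) u v) (h - 0)"
  proof (rule mvt_simple[OF \<open>h > 0\<close>])
    fix a assume a: "0 \<le> a" "a \<le> h"
    have "(z + b *\<^sub>R v) + a *\<^sub>R u \<in> W"
      using W[of a b] a b by (simp add: algebra_simps)
    then have "((\<lambda>w. f' w v) has_derivative (\<lambda>y. f'' ((z + b *\<^sub>R v) + a *\<^sub>R u) y v))
        (at ((z + b *\<^sub>R v) + a *\<^sub>R u))"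
      by (auto intro!: derivative_eq_intros f'')
    then show "(q has_derivative (\<lambda>y. y *\<^sub>R f'' ((z + b *\<^sub>R v) + a *\<^sub>R u) u v)) (at a within {0..h})"
      unfolding q_def has_vector_derivative_def[symmetric]
      by (rule has_derivative_along_line)
  qed
  then obtain a where a: "0 < a" "a < h" "q h - q 0 = h * f'' ((z + b *\<^sub>R v) + a *\<^sub>R u) u v" by auto
  show thesis
  proof (rule that[of a b])
    have "p h - p 0 = h * (q h - q 0)"
      using b(3) by (simp add: q_def algebra_simps)
    then show "f (z + h *\<^sub>R u + h *\<^sub>R v) - f (z + h *\<^sub>R u) - f (z + h *\<^sub>R v) + f z
       = h * (h * f'' (z + a *\<^sub>R u + b *\<^sub>R v) u v)"
      unfolding a(3) by (simp add: p_def algebra_simps)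
  qed (use a b in auto)
qed

text \<open>The second difference of \<open>f\<close> at \<open>z\<close> is symmetric in \<open>u\<close> and \<open>v\<close>; divided by \<open>h\<^sup>2\<close> it tends to
  \<open>f'' z u v\<close> or \<open>f'' z v u\<close>, according to the order in which the mean value theorem is applied.\<close>

lemma second_derivative_symmetric:
  fixes f :: "'a::real_normed_vector \<Rightarrow> real"
  assumes "open W" "z \<in> W"
    and f': "\<And>w. w \<in> W \<Longrightarrow> (f has_derivative blinfun_apply (f' w)) (at w)"
    and f'': "\<And>w. w \<in> W \<Longrightarrow> (f' has_derivative blinfun_apply (f'' w)) (at w)"
    and cont: "continuous_on W f''"
  shows "f'' z u v = f'' z v u"
proof -
  define h where "h n = inverse (real (Suc n))" for n
  have h_pos: "h n > 0" for n by (simp add: h_def)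
  have h0: "h \<longlonglongrightarrow> 0" unfolding h_def by (rule LIMSEQ_inverse_real_of_nat)
  obtain e where e: "e > 0" "ball z e \<subseteq> W"
    using \<open>open W\<close> \<open>z \<in> W\<close> by (meson openE)
  have pos: "0 < norm u + norm v + 1" by (simp add: add_nonneg_pos)
  \<comment> \<open>With sides shorter than \<open>d\<close> the parallelogram at \<open>z\<close>
    stays in the ball of radius \<open>e\<close>; the summand 1 avoids division by zero when
    \<open>u\<close> and \<open>v\<close> vanish.\<close>
  define d where "d = e / (norm u + norm v + 1)"
  have "d > 0" unfolding d_def using e pos by simp
  have inW: "z + a *\<^sub>R u + b *\<^sub>R v \<in> W" if "0 \<le> a" "a \<le> k" "0 \<le> b" "b \<le> k" "k < d" for a b k
  proof -
    have "norm (a *\<^sub>R u + b *\<^sub>R v) \<le> k * norm u + k * norm v"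
      using that by (intro order.trans[OF norm_triangle_ineq] add_mono) (auto intro!: mult_right_mono)
    also have "\<dots> \<le> k * (norm u + norm v + 1)" using that by (simp add: algebra_simps)
    also have "\<dots> < d * (norm u + norm v + 1)" using that pos
      by (intro mult_strict_right_mono)
    also have "\<dots> = e" unfolding d_def using pos by simp
    finally have "dist (z + a *\<^sub>R u + b *\<^sub>R v) z < e"
      by (simp add: dist_norm add.assoc)
    then show ?thesis using e by (auto simp: dist_commute)
  qed
  have ex: "\<exists>a b a' b'. 0 < a \<and> a < h n \<and> 0 < b \<and> b < h n \<and> 0 < a' \<and> a' < h n \<and> 0 < b' \<and> b' < h n \<and>
      f'' (z + a *\<^sub>R u + b *\<^sub>R v) u v = f'' (z + a' *\<^sub>R v + b' *\<^sub>R u) v u" if "h n < d" for n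
  proof -
    obtain a b where ab: "0 < a" "a < h n" "0 < b" "b < h n"
      "f (z + h n *\<^sub>R u + h n *\<^sub>R v) - f (z + h n *\<^sub>R u) - f (z + h n *\<^sub>R v) + f z
       = h n * (h n * f'' (z + a *\<^sub>R u + b *\<^sub>R v) u v)"
    proof (rule second_difference_mean_value[OF h_pos _ f' f''])
      show "z + a *\<^sub>R u + b *\<^sub>R v \<in> W" if "0 \<le> a" "a \<le> h n" "0 \<le> b" "b \<le> h n" for a b
        using inW[of a "h n" b] that \<open>h n < d\<close> by simp
    qed
    obtain a' b' where ab': "0 < a'" "a' < h n" "0 < b'" "b' < h n"
      "f (z + h n *\<^sub>R v + h n *\<^sub>R u) - f (z + h n *\<^sub>R v) - f (z + h n *\<^sub>R u) + f z
       = h n * (h n * f'' (z + a' *\<^sub>R v + b' *\<^sub>R u) v u)"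
    proof (rule second_difference_mean_value[OF h_pos _ f' f''])
      show "z + a *\<^sub>R v + b *\<^sub>R u \<in> W" if "0 \<le> a" "a \<le> h n" "0 \<le> b" "b \<le> h n" for a b
        using inW[of b "h n" a] that \<open>h n < d\<close> by (simp add: algebra_simps)
    qed
    have "h n * (h n * f'' (z + a *\<^sub>R u + b *\<^sub>R v) u v) = h n * (h n * f'' (z + a' *\<^sub>R v + b' *\<^sub>R u) v u)"
      using ab(5) ab'(5) by (simp add: algebra_simps)
    then have "f'' (z + a *\<^sub>R u + b *\<^sub>R v) u v = f'' (z + a' *\<^sub>R v + b' *\<^sub>R u) v u"
      using h_pos[of n] by simp
    then show ?thesis using ab ab' by blast
  qed
  obtain a b a' b' where ab: "\<And>n. h n < d \<Longrightarrow> 0 < a n \<and> a n < h n \<and> 0 < b n \<and> b n < h n \<and>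
      0 < a' n \<and> a' n < h n \<and> 0 < b' n \<and> b' n < h n \<and>
      f'' (z + a n *\<^sub>R u + b n *\<^sub>R v) u v = f'' (z + a' n *\<^sub>R v + b' n *\<^sub>R u) v u"
    using ex by metis
  have small: "eventually (\<lambda>n. h n < d) sequentially"
    using order_tendstoD(2)[OF h0 \<open>d > 0\<close>] .
  \<comment> \<open>The intermediate values are controlled only once \<open>h n < d\<close>, so the
    squeeze between 0 and \<open>h\<close> holds eventually.\<close>
  have lim: "x \<longlonglongrightarrow> 0" if "\<And>n. h n < d \<Longrightarrow> 0 < x n \<and> x n < h n" for x :: "nat \<Rightarrow> real"
    by (rule tendsto_sandwich[OF _ _ tendsto_const h0])
       (use that in \<open>auto intro: eventually_mono[OF small] less_imp_le\<close>)
  have isCont: "isCont f'' z"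
    using cont \<open>open W\<close> \<open>z \<in> W\<close> by (simp add: continuous_on_eq_continuous_at)
  have L1: "(\<lambda>n. f'' (z + a n *\<^sub>R u + b n *\<^sub>R v) u v) \<longlonglongrightarrow> f'' z u v"
  proof -
    have "(\<lambda>n. z + a n *\<^sub>R u + b n *\<^sub>R v) \<longlonglongrightarrow> z + 0 *\<^sub>R u + 0 *\<^sub>R v"
      using ab by (intro tendsto_intros lim) auto
    then have "(\<lambda>n. f'' (z + a n *\<^sub>R u + b n *\<^sub>R v)) \<longlonglongrightarrow> f'' z"
      by (intro isCont_tendsto_compose[OF isCont]) simp
    then show ?thesis by (intro tendsto_intros)
  qed
  have L2: "(\<lambda>n. f'' (z + a' n *\<^sub>R v + b' n *\<^sub>R u) v u) \<longlonglongrightarrow> f'' z v u"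
  proof -
    have "(\<lambda>n. z + a' n *\<^sub>R v + b' n *\<^sub>R u) \<longlonglongrightarrow> z + 0 *\<^sub>R v + 0 *\<^sub>R u"
      using ab by (intro tendsto_intros lim) auto
    then have "(\<lambda>n. f'' (z + a' n *\<^sub>R v + b' n *\<^sub>R u)) \<longlonglongrightarrow> f'' z"
      by (intro isCont_tendsto_compose[OF isCont]) simp
    then show ?thesis by (intro tendsto_intros)
  qed
  have "eventually (\<lambda>n. f'' (z + a' n *\<^sub>R v + b' n *\<^sub>R u) v u = f'' (z + a n *\<^sub>R u + b n *\<^sub>R v) u v) sequentially"
    by (rule eventually_mono[OF small]) (use ab in metis)
  then have "(\<lambda>n. f'' (z + a n *\<^sub>R u + b n *\<^sub>R v) u v) \<longlonglongrightarrow> f'' z v u"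
    using L2 tendsto_cong by fast
  then show ?thesis using L1 LIMSEQ_unique by blast
qed

section \<open>Continuous functions on open sets\<close>

text \<open>Continuity makes the set of nonzero values open, and a nonempty open set is never
  Lebesgue-null. This turns equations valid almost everywhere into pointwise ones.\<close>

lemma open_AE_zero_imp_zero:
  fixes f :: "'a::euclidean_space \<Rightarrow> 'b::{t1_space,zero}"
  assumes "open W" "continuous_on W f" and ae: "AE z in lborel. z \<in> W \<longrightarrow> f z = 0" and "w \<in> W"
  shows "f w = 0"
proof (rule ccontr)
  assume ne: "f w \<noteq> 0"
  define N where "N = {z \<in> W. f z \<noteq> 0}"
  have "N = f -` (- {0}) \<inter> W" by (auto simp: N_def)
  then have "open N"
    using assms continuous_on_open_vimage by (metis open_delete open_UNIV Compl_eq_Diff_UNIV)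
  moreover have "w \<in> N" using ne \<open>w \<in> W\<close> by (simp add: N_def)
  moreover have "N \<in> null_sets lborel"
    using ae \<open>open N\<close> by (subst AE_iff_null_sets) (auto simp: N_def elim: eventually_mono)
  ultimately show False
    using open_not_negligible[of N]
    by (auto simp: negligible_iff_null_sets intro: null_sets_completionI)
qed

text \<open>The components of an open set of reals are open intervals, each carrying an
  antiderivative, and no matching between components is needed. This will produce the phase, since
  the time projection of a region need not be an interval.\<close>

lemma antiderivative_open_real:
  fixes c :: "real \<Rightarrow> real"
  assumes "open T" "continuous_on T c"
  obtains F where "\<And>t. t \<in> T \<Longrightarrow> (F has_vector_derivative c t) (at t)"
proof -
  have ex: "\<exists>F. \<forall>t\<in>C. (F has_vector_derivative c t) (at t)" if "C \<in> components T" for C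
  proof -
    have C: "C \<noteq> {}" "connected C" "open C" "C \<subseteq> T"
      using that in_components_nonempty in_components_connected open_components[OF \<open>open T\<close>]
        in_components_subset by blast+
    \<comment> \<open>Endpoints are taken in the extended reals because a component may be
      unbounded.\<close>
    define a where "a = Inf (ereal ` C)"
    define b where "b = Sup (ereal ` C)"
    have mem: "t \<in> C \<longleftrightarrow> a < ereal t \<and> ereal t < b" for t
    proof
      assume "t \<in> C"
      then obtain e where e: "e > 0" "cball t e \<subseteq> C"
        using \<open>open C\<close> open_contains_cball by blast
      have "t - e \<in> C" "t + e \<in> C" using e by (auto simp: subset_eq dist_real_def)
      then have "a \<le> ereal (t - e)" "ereal (t + e) \<le> b"
        unfolding a_def b_def by (auto intro: Inf_lower Sup_upper)
      then show "a < ereal t \<and> ereal t < b"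
        using e(1) by (meson ereal_less_eq(3) le_less_trans less_le_trans less_ereal.simps(1)
            diff_less_eq less_add_same_cancel1)
    next
      assume "a < ereal t \<and> ereal t < b"
      then obtain x y where "x \<in> C" "y \<in> C" "x < t" "t < y"
        unfolding a_def b_def by (auto simp: Inf_less_iff less_Sup_iff)
      then show "t \<in> C" using \<open>connected C\<close> connectedD_interval by (metis less_imp_le)
    qed
    have "a < b" using C(1) mem by (metis ex_in_conv order.strict_trans)
    moreover have "isCont c t" if "a < ereal t" "ereal t < b" for t
      using assms that mem C by (auto simp: continuous_on_eq_continuous_at)
    ultimately show ?thesis
      using einterval_antiderivative[of a b c] mem by auto
  qed
  obtain G where G: "\<And>C t. C \<in> components T \<Longrightarrow> t \<in> C \<Longrightarrow> (G C has_vector_derivative c t) (at t)"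
    using ex by metis
  \<comment> \<open>Each time uses the antiderivative of its own component; components are open, so
    \<open>F\<close> agrees with a single \<open>G C\<close> near every point of
    \<open>T\<close>.\<close>
  define F where "F t = G (connected_component_set T t) t" for t
  have "(F has_vector_derivative c t) (at t)" if "t \<in> T" for t
  proof -
    let ?C = "connected_component_set T t"
    have C: "?C \<in> components T" "t \<in> ?C" "open ?C"
      using that \<open>open T\<close> by (auto simp: components_def intro: open_connected_component)
    have "F s = G ?C s" if "s \<in> ?C" for s
      unfolding F_def using connected_component_eq[OF that] by simp
    then show ?thesis
      using G[OF C(1,2)] C has_vector_derivative_transform_within_open
      by (metis (no_types, lifting))
  qed
  then show thesis by (rule that)
qed

section \<open>Fields of class C1 and C2\<close>

lemma GDERIV_of_has_derivative:
  fixes f :: "real^'n \<Rightarrow> real"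
  assumes "(f has_derivative D) (at r)"
  shows "GDERIV f r :> (\<chi> i. D (axis i 1))"
proof -
  have "linear D" using assms by (rule has_derivative_linear)
  have "D h = h \<bullet> (\<chi> i. D (axis i 1))" for h
  proof -
    have "D h = D (\<Sum>i\<in>UNIV. h $ i *\<^sub>R axis i 1)"
      using basis_expansion[of h] by (simp add: scalar_mult_eq_scaleR)
    also have "\<dots> = (\<Sum>i\<in>UNIV. h $ i * D (axis i 1))"
      using \<open>linear D\<close> by (simp add: linear_sum linear_scale)
    finally show ?thesis by (simp add: inner_vec_def)
  qed
  then have "D = (\<lambda>h. h \<bullet> (\<chi> i. D (axis i 1)))" by blast
  then show ?thesis using assms unfolding gderiv_def by metis
qed

lemma GDERIV_unique:
  assumes "GDERIV f x :> D" "GDERIV f x :> D'"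
  shows "D = D'"
proof -
  have "(\<lambda>h. h \<bullet> D) = (\<lambda>h. h \<bullet> D')"
    using assms unfolding gderiv_def by (rule has_derivative_unique)
  then have "\<forall>h. h \<bullet> D = h \<bullet> D'" by meson
  then show ?thesis by (simp add: vector_eq_ldot)
qed

lemma grad_eq: "GDERIV f r :> D \<Longrightarrow> grad f r = D"
  unfolding grad_def using GDERIV_unique by blast

lemma GDERIV_transform:
  assumes "GDERIV f x :> D" "open X" "x \<in> X" "\<And>y. y \<in> X \<Longrightarrow> f y = g y"
  shows "GDERIV g x :> D"
  using assms unfolding gderiv_def by (rule has_derivative_transform_within_open)

lemma divergence_eq:
  assumes "(F has_derivative D) (at r)"
  shows "divergence F r = (\<Sum>i\<in>UNIV. D (axis i 1) $ i)"
  by (simp add: divergence_def jacobian_def trace_def matrix_def frechet_derivative_at[OF assms, symmetric])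

lemma open_space_slice: "open W \<Longrightarrow> open {x. (t, x) \<in> W}"
  using open_vimage[of W "\<lambda>x. (t, x)"] by (simp add: vimage_def continuous_intros)

lemma open_time_slice: "open W \<Longrightarrow> open {s. (s, x) \<in> W}"
  using open_vimage[of W "\<lambda>s. (s, x)"] by (simp add: vimage_def continuous_intros)

text \<open>The space-time derivatives are read off along \<open>(1, 0)\<close> and
  \<open>(0, axis i 1)\<close>: \<open>\<tau>\<close> is the time derivative, \<open>g\<close> the
  spatial gradient, \<open>H\<close> the spatial Hessian. The essential point is that one field
  \<open>\<omega>\<close> is both the gradient of \<open>\<tau>\<close> and the time derivative of
  \<open>g\<close>.\<close>

lemma C2_on_field:
  fixes f :: "real field"
  assumes "open W" "C2_on W (\<lambda>(t, r). f t r)"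
  obtains \<tau> g \<omega> H where
    "\<And>t r. (t, r) \<in> W \<Longrightarrow> ((\<lambda>s. f s r) has_vector_derivative \<tau> (t, r)) (at t)"
    "\<And>t r. (t, r) \<in> W \<Longrightarrow> GDERIV (f t) r :> g (t, r)"
    "\<And>t r. (t, r) \<in> W \<Longrightarrow> GDERIV (\<lambda>x. \<tau> (t, x)) r :> \<omega> (t, r)"
    "\<And>t r. (t, r) \<in> W \<Longrightarrow> ((\<lambda>s. g (s, r)) has_vector_derivative \<omega> (t, r)) (at t)"
    "\<And>t r. (t, r) \<in> W \<Longrightarrow> ((\<lambda>x. g (t, x)) has_derivative H (t, r)) (at r)"
    "continuous_on W (\<lambda>(t, r). f t r)" "continuous_on W \<tau>" "continuous_on W g" "continuous_on W \<omega>"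
    "\<And>h. continuous_on W (\<lambda>z. H z h)"
proof -
  let ?F = "\<lambda>(t, r). f t r"
  obtain f' where f': "\<And>z. z \<in> W \<Longrightarrow> (?F has_derivative blinfun_apply (f' z)) (at z)" and "C1_on W f'"
    using assms(2) unfolding C2_on_def by blast
  then obtain f'' where f'': "\<And>z. z \<in> W \<Longrightarrow> (f' has_derivative blinfun_apply (f'' z)) (at z)"
    and contf'': "continuous_on W f''"
    unfolding C1_on_def by blast
  have contf': "continuous_on W f'"
    using f'' \<open>open W\<close> by (meson continuous_at_imp_continuous_on has_derivative_continuous)
  have contF: "continuous_on W ?F"
    using f' \<open>open W\<close> by (meson continuous_at_imp_continuous_on has_derivative_continuous)
  have sym: "f'' z u v = f'' z v u" if "z \<in> W" for z u v
    using second_derivative_symmetric[OF \<open>open W\<close> that f' f'' contf''] .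
  have f'_dir: "((\<lambda>w. f' w v) has_derivative (\<lambda>u. f'' z u v)) (at z)" if "z \<in> W" for z v
    by (auto intro!: derivative_eq_intros f''[OF that])
  have time: "((\<lambda>s. G (s, r)) has_vector_derivative D (1, 0)) (at t)"
    if "(G has_derivative D) (at (t, r))" for G :: "real \<times> (real^3) \<Rightarrow> real" and D t r
  proof -
    have "((\<lambda>s. (s, r)) has_derivative (\<lambda>h. (h, 0))) (at t)"
      by (auto intro!: derivative_eq_intros)
    then have "((\<lambda>s. G (s, r)) has_derivative (\<lambda>h. D (h, 0))) (at t)"
      using that by (rule has_derivative_compose)
    moreover have "D (h, 0) = h *\<^sub>R D (1, 0)" for h
      using linear_scale[OF has_derivative_linear[OF that], of h "(1, 0)"]
      by (simp only: scaleR_Pair real_scaleR_def mult_1_right scaleR_zero_right)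
    then have "(\<lambda>h. D (h, 0)) = (\<lambda>h. h *\<^sub>R D (1, 0))" ..
    ultimately show ?thesis unfolding has_vector_derivative_def by (rule back_subst)
  qed
  have space: "((\<lambda>x. G (t, x)) has_derivative (\<lambda>h. D (0, h))) (at r)"
    if "(G has_derivative D) (at (t, r))" for G :: "real \<times> (real^3) \<Rightarrow> real" and D t r
  proof -
    have "((\<lambda>x. (t, x)) has_derivative (\<lambda>h. (0, h))) (at r)"
      by (auto intro!: derivative_eq_intros)
    then show ?thesis using that by (rule has_derivative_compose)
  qed
  define \<tau> where "\<tau> z = f' z (1, 0)" for z
  define g where "g z = (\<chi> i. f' z (0, axis i 1))" for z
  define \<omega> where "\<omega> z = (\<chi> i. f'' z (1, 0) (0, axis i 1))" for z
  define H where "H z h = (\<chi> i. f'' z (0, h) (0, axis i 1))" for z h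
  have dt_f: "((\<lambda>s. f s r) has_vector_derivative \<tau> (t, r)) (at t)" if "(t, r) \<in> W" for t r
    using time[OF f'[OF that]] by (simp add: \<tau>_def)
  have grad_f: "GDERIV (f t) r :> g (t, r)" if "(t, r) \<in> W" for t r
    using GDERIV_of_has_derivative[OF space[OF f'[OF that]]] by (simp add: g_def)
  \<comment> \<open>The chain rule gives \<open>f''\<close> with arguments
    \<open>(0, axis i 1)\<close> and \<open>(1, 0)\<close>; symmetry exchanges them to match
    \<open>\<omega>\<close>.\<close>
  have grad_dt: "GDERIV (\<lambda>x. \<tau> (t, x)) r :> \<omega> (t, r)" if "(t, r) \<in> W" for t r
    using GDERIV_of_has_derivative[OF space[OF f'_dir[OF that]]] sym[OF that]
    by (simp add: \<tau>_def \<omega>_def)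
  have dt_grad: "((\<lambda>s. g (s, r)) has_vector_derivative \<omega> (t, r)) (at t)" if "(t, r) \<in> W" for t r
    unfolding has_vector_derivative_def
  proof (subst has_derivative_componentwise_within, intro ballI)
    fix b :: "real^3" assume "b \<in> Basis"
    then obtain i where b: "b = axis i 1" by (auto simp: Basis_vec_def)
    show "((\<lambda>s. g (s, r) \<bullet> b) has_derivative (\<lambda>h. (h *\<^sub>R \<omega> (t, r)) \<bullet> b)) (at t)"
      using time[OF f'_dir[OF that, of "(0, axis i 1)"]]
      by (simp add: has_vector_derivative_def b g_def \<omega>_def inner_axis)
  qed
  have hess: "((\<lambda>x. g (t, x)) has_derivative H (t, r)) (at r)" if "(t, r) \<in> W" for t r
  proof (subst has_derivative_componentwise_within, intro ballI)
    fix b :: "real^3" assume "b \<in> Basis"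
    then obtain i where b: "b = axis i 1" by (auto simp: Basis_vec_def)
    show "((\<lambda>x. g (t, x) \<bullet> b) has_derivative (\<lambda>h. H (t, r) h \<bullet> b)) (at r)"
      using space[OF f'_dir[OF that, of "(0, axis i 1)"]]
      by (simp add: b g_def H_def inner_axis)
  qed
  have cont: "continuous_on W \<tau>" "continuous_on W g" "continuous_on W \<omega>" "continuous_on W (\<lambda>z. H z h)" for h
    unfolding \<tau>_def g_def \<omega>_def H_def
    by (intro continuous_on_vec_lambda continuous_intros contf' contf'')+
  show thesis
    using that[OF dt_f grad_f grad_dt dt_grad hess contF cont] .
qed

section \<open>Algebra of fields with continuous spatial gradient\<close>

lemma space_C1_on_const: "space_C1_on W (\<lambda>t r. c)"
  unfolding space_C1_on_def by (auto intro!: exI[of _ "\<lambda>_. 0"] GDERIV_const)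

lemma space_C1_on_add:
  assumes "space_C1_on W f" "space_C1_on W g"
  shows "space_C1_on W (\<lambda>t r. f t r + g t r)"
proof -
  obtain f' g' where *: "\<forall>(t, r)\<in>W. GDERIV (f t) r :> f' (t, r)" "continuous_on W f'"
    "\<forall>(t, r)\<in>W. GDERIV (g t) r :> g' (t, r)" "continuous_on W g'"
    "continuous_on W (\<lambda>(t, r). f t r)" "continuous_on W (\<lambda>(t, r). g t r)"
    using assms unfolding space_C1_on_def by blast
  have "GDERIV (\<lambda>r. f t r + g t r) r :> f' (t, r) + g' (t, r)" if "(t, r) \<in> W" for t r
    using that * by (intro GDERIV_add) auto
  then show ?thesis unfolding space_C1_on_def
    using * by (auto simp: case_prod_unfold intro!: continuous_intros exI[of _ "\<lambda>z. f' z + g' z"])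
qed

lemma space_C1_on_mult:
  assumes "space_C1_on W f" "space_C1_on W g"
  shows "space_C1_on W (\<lambda>t r. f t r * g t r)"
proof -
  obtain f' g' where *: "\<forall>(t, r)\<in>W. GDERIV (f t) r :> f' (t, r)" "continuous_on W f'"
    "\<forall>(t, r)\<in>W. GDERIV (g t) r :> g' (t, r)" "continuous_on W g'"
    "continuous_on W (\<lambda>(t, r). f t r)" "continuous_on W (\<lambda>(t, r). g t r)"
    using assms unfolding space_C1_on_def by blast
  have "GDERIV (\<lambda>r. f t r * g t r) r :> f t r *\<^sub>R g' (t, r) + g t r *\<^sub>R f' (t, r)" if "(t, r) \<in> W" for t r
    using that * by (intro GDERIV_mult) auto
  then show ?thesis unfolding space_C1_on_def
    using * by (auto simp: case_prod_unfold intro!: continuous_intros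
        exI[of _ "\<lambda>z. f (fst z) (snd z) *\<^sub>R g' z + g (fst z) (snd z) *\<^sub>R f' z"])
qed

lemma space_C1_on_inverse:
  assumes "space_C1_on W f" "\<And>t r. (t, r) \<in> W \<Longrightarrow> f t r \<noteq> 0"
  shows "space_C1_on W (\<lambda>t r. inverse (f t r))"
proof -
  obtain f' where *: "\<forall>(t, r)\<in>W. GDERIV (f t) r :> f' (t, r)" "continuous_on W f'"
    "continuous_on W (\<lambda>(t, r). f t r)"
    using assms unfolding space_C1_on_def by blast
  have "GDERIV (\<lambda>r. inverse (f t r)) r :> - (inverse (f t r))\<^sup>2 *\<^sub>R f' (t, r)" if "(t, r) \<in> W" for t r
    using that * assms(2) by (intro GDERIV_inverse) auto
  then show ?thesis unfolding space_C1_on_def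
    using * assms(2) by (auto simp: case_prod_unfold intro!: continuous_intros
        exI[of _ "\<lambda>z. - (inverse (f (fst z) (snd z)))\<^sup>2 *\<^sub>R f' z"])
qed

lemma space_C1_on_cong:
  assumes "space_C1_on W f" "open W" "\<And>t r. (t, r) \<in> W \<Longrightarrow> f t r = g t r"
  shows "space_C1_on W g"
proof -
  obtain f' where *: "\<forall>(t, r)\<in>W. GDERIV (f t) r :> f' (t, r)" "continuous_on W f'"
    "continuous_on W (\<lambda>(t, r). f t r)"
    using assms unfolding space_C1_on_def by blast
  have "GDERIV (g t) r :> f' (t, r)" if "(t, r) \<in> W" for t r
    by (rule GDERIV_transform[of "f t" _ _ "{x. (t, x) \<in> W}"])
       (use that * assms open_space_slice in auto)
  moreover have "continuous_on W (\<lambda>(t, r). g t r)"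
    by (rule continuous_on_eq[OF *(3)]) (use assms in auto)
  ultimately show ?thesis unfolding space_C1_on_def using * by blast
qed

text \<open>By the product rule the gradient has components
  \<open>2 * (g \<bullet> H (axis i 1))\<close>, so continuity of \<open>H\<close> in each fixed
  direction is enough. This handles the squared lengths of the gradients of \<open>\<rho>\<close>
  and \<open>S\<close>.\<close>

lemma space_C1_on_inner_self:
  fixes g :: "real \<times> (real^3) \<Rightarrow> real^3"
  assumes "\<And>t r. (t, r) \<in> W \<Longrightarrow> ((\<lambda>x. g (t, x)) has_derivative H (t, r)) (at r)"
    and "continuous_on W g" "\<And>h. continuous_on W (\<lambda>z. H z h)"
  shows "space_C1_on W (\<lambda>t r. g (t, r) \<bullet> g (t, r))"
proof -
  have "GDERIV (\<lambda>x. g (t, x) \<bullet> g (t, x)) r :> (\<chi> i. 2 * (g (t, r) \<bullet> H (t, r) (axis i 1)))"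
    if "(t, r) \<in> W" for t r
  proof -
    have "((\<lambda>x. g (t, x) \<bullet> g (t, x)) has_derivative (\<lambda>h. 2 * (g (t, r) \<bullet> H (t, r) h))) (at r)"
      by (auto intro!: derivative_eq_intros assms(1)[OF that] simp: inner_commute)
    from GDERIV_of_has_derivative[OF this] show ?thesis .
  qed
  then show ?thesis unfolding space_C1_on_def
    using assms(2,3) by (auto simp: case_prod_unfold
        intro!: continuous_intros continuous_on_vec_lambda exI[of _ "\<lambda>z. \<chi> i. 2 * (g z \<bullet> H z (axis i 1))"])
qed

section \<open>The residual of the energy equation\<close>

text \<open>The factor \<open>\<rho>\<close> cancels the denominator of \<open>u\<close> on the
  neighbourhood \<open>X\<close>, leaving a constant multiple of \<open>g\<close>, so a multiple of
  the Laplacian of \<open>\<rho>\<close> results. The factor \<open>k\<close> covers both uses: 1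
  for the pressure and \<open>m\<close> for
  \<open>\<nabla>\<cdot>(\<rho>\<^sub>m u)\<close>.\<close>

lemma divergence_density_vel_u:
  assumes "open X" "r \<in> X" "\<And>x. x \<in> X \<Longrightarrow> \<rho> t x \<noteq> 0" "\<And>x. x \<in> X \<Longrightarrow> GDERIV (\<rho> t) x :> g x"
    and "(g has_derivative G) (at r)"
  shows "divergence (\<lambda>x. (k * \<rho> t x) *\<^sub>R vel_u hbar m \<rho> t x) r
    = - k * zeta hbar m * (\<Sum>i\<in>UNIV. G (axis i 1) $ i)"
proof -
  have "((\<lambda>x. (- k * zeta hbar m) *\<^sub>R g x) has_derivative (\<lambda>h. (- k * zeta hbar m) *\<^sub>R G h)) (at r)"
    by (intro derivative_intros assms)
  then have "((\<lambda>x. (k * \<rho> t x) *\<^sub>R vel_u hbar m \<rho> t x) has_derivative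
      (\<lambda>h. (- k * zeta hbar m) *\<^sub>R G h)) (at r)"
    by (rule has_derivative_transform_within_open[OF _ assms(1,2)])
       (use assms(3) in \<open>simp add: vel_u_def grad_eq[OF assms(4)]\<close>)
  from divergence_eq[OF this] show ?thesis by (simp add: sum_distrib_left sum_negf)
qed

lemma pressure_eq:
  assumes "open X" "r \<in> X" "\<And>x. x \<in> X \<Longrightarrow> \<rho> t x \<noteq> 0" "\<And>x. x \<in> X \<Longrightarrow> GDERIV (\<rho> t) x :> g x"
    and "(g has_derivative G) (at r)"
  shows "pressure hbar m \<rho> t r = - zeta0 hbar * zeta hbar m * (\<Sum>i\<in>UNIV. G (axis i 1) $ i)"
  using divergence_density_vel_u[of X r \<rho> t g G 1 hbar m, OF assms] by (simp add: pressure_def)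

text \<open>This is the residual of the quantum Hamilton-Jacobi equation: where
  \<open>\<rho>\<close> is positive and twice continuously differentiable,
  \<open>m/2 |u|\<^sup>2 + P/\<rho>\<close> is the Bohm quantum potential.\<close>

definition residual ::
  "real \<Rightarrow> real \<Rightarrow> real field \<Rightarrow> real field \<Rightarrow> real field \<Rightarrow> real field" where
  "residual hbar m U \<rho> S t r =
     energy S t r
     - m / 2 * ((norm (vel_u hbar m \<rho> t r))\<^sup>2 + (norm (vel_v m S t r))\<^sup>2)
     - pressure hbar m \<rho> t r / \<rho> t r - U t r"

lemma energy_equation_iff_residual:
  assumes "\<rho> t r \<noteq> 0"
  shows "energy_equation hbar m U \<rho> S t r \<longleftrightarrow> residual hbar m U \<rho> S t r = 0"
proof -
  have "residual hbar m U \<rho> S t r * \<rho> t r = energy S t r * \<rho> t r -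
      (1/2 * mass_density m \<rho> t r * (norm (vel_u hbar m \<rho> t r))\<^sup>2
       + 1/2 * mass_density m \<rho> t r * (norm (vel_v m S t r))\<^sup>2
       + pressure hbar m \<rho> t r + U t r * \<rho> t r)"
    using assms by (simp add: residual_def mass_density_def field_simps)
  then show ?thesis using assms unfolding energy_equation_def by (metis eq_iff_diff_eq_0 mult_eq_0_iff)
qed

text \<open>Adding a constant does not change which vectors qualify as gradient, so the two definite
  descriptions coincide even where no gradient exists.\<close>

lemma grad_add_const: "grad (\<lambda>x. f x + c) r = grad f r"
proof -
  have "GDERIV (\<lambda>x. f x + c) r :> D \<longleftrightarrow> GDERIV f r :> D" for D
    using GDERIV_add[of f r D "\<lambda>_. c" 0] GDERIV_add[of "\<lambda>x. f x + c" r D "\<lambda>_. - c" 0]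
    by (auto simp: GDERIV_const)
  then show ?thesis by (simp add: grad_def)
qed

text \<open>A phase depending on time alone leaves \<open>u\<close>, \<open>v\<close> and
  \<open>P\<close> unchanged and enters only through \<open>E\<close>.\<close>

lemma residual_add_phase:
  assumes "((\<lambda>s. S s r) has_vector_derivative \<tau>) (at t)" "(\<theta> has_vector_derivative c) (at t)"
  shows "residual hbar m U \<rho> (\<lambda>t r. S t r + \<theta> t) t r = residual hbar m U \<rho> S t r - c"
proof -
  have "dt (\<lambda>t r. S t r + \<theta> t) t r = dt S t r + c"
    unfolding dt_def using vector_derivative_at[OF has_vector_derivative_add[OF assms]]
      vector_derivative_at[OF assms(1)] by simp
  then show ?thesis
    by (simp add: residual_def energy_def vel_v_def grad_add_const)
qed

lemma space_C1_on_kinetic: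
  assumes "open W" "C2_on W (\<lambda>(t, r). \<rho> t r)" "C2_on W (\<lambda>(t, r). S t r)"
    and \<rho>: "\<And>t r. (t, r) \<in> W \<Longrightarrow> \<rho> t r \<noteq> 0"
  shows "space_C1_on W (\<lambda>t r. (norm (vel_u hbar m \<rho> t r))\<^sup>2 + (norm (vel_v m S t r))\<^sup>2)"
proof -
  obtain g G where g: "\<And>t r. (t, r) \<in> W \<Longrightarrow> GDERIV (\<rho> t) r :> g (t, r)"
    "\<And>t r. (t, r) \<in> W \<Longrightarrow> ((\<lambda>x. g (t, x)) has_derivative G (t, r)) (at r)"
    "continuous_on W (\<lambda>(t, r). \<rho> t r)" "continuous_on W g" "\<And>h. continuous_on W (\<lambda>z. G z h)"
    using C2_on_field[OF assms(1,2)] by metis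
  obtain k K where k: "\<And>t r. (t, r) \<in> W \<Longrightarrow> GDERIV (S t) r :> k (t, r)"
    "\<And>t r. (t, r) \<in> W \<Longrightarrow> ((\<lambda>x. k (t, x)) has_derivative K (t, r)) (at r)"
    "continuous_on W k" "\<And>h. continuous_on W (\<lambda>z. K z h)"
    using C2_on_field[OF assms(1,3)] by metis
  have "space_C1_on W \<rho>"
    unfolding space_C1_on_def using g by blast
  then have "space_C1_on W (\<lambda>t r.
      (zeta hbar m)\<^sup>2 * ((inverse (\<rho> t r) * inverse (\<rho> t r)) * (g (t, r) \<bullet> g (t, r)))
      + (1 / m)\<^sup>2 * (k (t, r) \<bullet> k (t, r)))"
    using space_C1_on_inner_self[OF g(2,4,5)] space_C1_on_inner_self[OF k(2,3,4)] \<rho>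
    by (intro space_C1_on_add space_C1_on_mult space_C1_on_const space_C1_on_inverse)
  then show ?thesis
  proof (rule space_C1_on_cong[OF _ \<open>open W\<close>])
    fix t r assume W: "(t, r) \<in> W"
    show "(zeta hbar m)\<^sup>2 * ((inverse (\<rho> t r) * inverse (\<rho> t r)) * (g (t, r) \<bullet> g (t, r)))
      + (1 / m)\<^sup>2 * (k (t, r) \<bullet> k (t, r)) = (norm (vel_u hbar m \<rho> t r))\<^sup>2 + (norm (vel_v m S t r))\<^sup>2"
      unfolding vel_u_def vel_v_def grad_eq[OF g(1)[OF W]] grad_eq[OF k(1)[OF W]]
        power2_norm_eq_inner inner_scaleR_left inner_scaleR_right
      by (simp add: power2_eq_square divide_inverse mult_ac)
  qed
qed

text \<open>The gradient is computed term by term. Continuity of \<open>D\<close> is part of the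
  conclusion because an Euler equation holding almost everywhere must later be turned into
  \<open>D = 0\<close> at every point.\<close>

lemma residual_gradient:
  assumes "m > 0" "hbar > 0" and reg: "regular_on hbar m U \<rho> S W"
    and \<rho>: "\<And>t r. (t, r) \<in> W \<Longrightarrow> \<rho> t r \<noteq> 0"
  obtains D where
    "continuous_on W (\<lambda>(t, r). residual hbar m U \<rho> S t r)" "continuous_on W D"
    "\<And>t r. (t, r) \<in> W \<Longrightarrow> GDERIV (residual hbar m U \<rho> S t) r :> D (t, r)"
    "\<And>t r. (t, r) \<in> W \<Longrightarrow> euler_equation hbar m U \<rho> S t r \<longleftrightarrow> D (t, r) = 0"
proof -
  have W: "open W" "C2_on W (\<lambda>(t, r). \<rho> t r)" "C2_on W (\<lambda>(t, r). S t r)"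
    using reg by (auto simp: regular_on_def)
  note slice = open_space_slice[OF W(1)]
  obtain g G where g: "\<And>t r. (t, r) \<in> W \<Longrightarrow> GDERIV (\<rho> t) r :> g (t, r)"
    "\<And>t r. (t, r) \<in> W \<Longrightarrow> ((\<lambda>x. g (t, x)) has_derivative G (t, r)) (at r)"
    "continuous_on W (\<lambda>(t, r). \<rho> t r)" "continuous_on W g"
    using C2_on_field[OF W(1,2)] by metis
  obtain \<tau> k \<omega> where S: "\<And>t r. (t, r) \<in> W \<Longrightarrow> ((\<lambda>s. S s r) has_vector_derivative \<tau> (t, r)) (at t)"
    "\<And>t r. (t, r) \<in> W \<Longrightarrow> GDERIV (S t) r :> k (t, r)"
    "\<And>t r. (t, r) \<in> W \<Longrightarrow> GDERIV (\<lambda>x. \<tau> (t, x)) r :> \<omega> (t, r)"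
    "\<And>t r. (t, r) \<in> W \<Longrightarrow> ((\<lambda>s. k (s, r)) has_vector_derivative \<omega> (t, r)) (at t)"
    "continuous_on W \<tau>" "continuous_on W \<omega>"
    using C2_on_field[OF W(1,3)] by metis
  let ?P = "pressure hbar m \<rho>"
  define N where "N = (\<lambda>t r. (norm (vel_u hbar m \<rho> t r))\<^sup>2 + (norm (vel_v m S t r))\<^sup>2)"
  obtain p where p: "\<forall>(t, r)\<in>W. GDERIV (?P t) r :> p (t, r)" "continuous_on W p"
    "continuous_on W (\<lambda>(t, r). ?P t r)"
    using reg unfolding regular_on_def space_C1_on_def by blast
  obtain u where u: "\<forall>(t, r)\<in>W. GDERIV (U t) r :> u (t, r)" "continuous_on W u"
    "continuous_on W (\<lambda>(t, r). U t r)"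
    using reg unfolding regular_on_def space_C1_on_def by blast
  obtain n where n: "\<forall>(t, r)\<in>W. GDERIV (N t) r :> n (t, r)" "continuous_on W n"
    "continuous_on W (\<lambda>(t, r). N t r)"
    using space_C1_on_kinetic[OF W \<rho>, where hbar = hbar and m = m] unfolding space_C1_on_def N_def by blast
  \<comment> \<open>The explicit \<open>\<tau>\<close> and \<open>inverse\<close> suit the gradient
    and continuity rules; agreement with the residual is available on \<open>W\<close>.\<close>
  define R where "R t r = - \<tau> (t, r) - (m / 2 * N t r + (?P t r * inverse (\<rho> t r) + U t r))" for t r
  have R: "R t r = residual hbar m U \<rho> S t r" if "(t, r) \<in> W" for t r
    unfolding R_def N_def residual_def energy_def dt_def vector_derivative_at[OF S(1)[OF that]]
    by (simp only: divide_inverse diff_diff_eq add.assoc)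
  define D where "D z = (case z of (t, r) \<Rightarrow> - \<omega> z - ((m / 2) *\<^sub>R n z +
    (?P t r *\<^sub>R (- (inverse (\<rho> t r))\<^sup>2 *\<^sub>R g z) + inverse (\<rho> t r) *\<^sub>R p z + u z)))" for z
  show thesis
  proof (rule that)
    have "continuous_on W (\<lambda>(t, r). R t r)"
      using S(5) n(3) p(3) u(3) g(3) \<rho> unfolding R_def case_prod_unfold
      by (intro continuous_intros) auto
    then show "continuous_on W (\<lambda>(t, r). residual hbar m U \<rho> S t r)"
      by (rule continuous_on_eq) (use R in auto)
    show "continuous_on W D"
      using S(6) n(2) p(2,3) u(2) g(3,4) \<rho> unfolding D_def case_prod_unfold
      by (intro continuous_intros) auto
  next
    fix t r assume tr: "(t, r) \<in> W"
    have "GDERIV (R t) r :> D (t, r)"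
    proof (rule GDERIV_subst)
      show "GDERIV (R t) r :> - \<omega> (t, r) - (((m / 2) *\<^sub>R n (t, r) + N t r *\<^sub>R 0) +
          ((?P t r *\<^sub>R (- (inverse (\<rho> t r))\<^sup>2 *\<^sub>R g (t, r)) + inverse (\<rho> t r) *\<^sub>R p (t, r)) + u (t, r)))"
        unfolding R_def
        using tr S(3) n(1) p(1) u(1) g(1) \<rho>
        by (intro GDERIV_diff GDERIV_minus GDERIV_add GDERIV_mult GDERIV_const GDERIV_inverse) auto
    qed (simp add: D_def)
    then show "GDERIV (residual hbar m U \<rho> S t) r :> D (t, r)"
      by (rule GDERIV_transform[OF _ slice]) (use tr R in auto)
  next
    fix t r assume tr: "(t, r) \<in> W"
    have near: "\<rho> t x \<noteq> 0" "GDERIV (\<rho> t) x :> g (t, x)" if "x \<in> {x. (t, x) \<in> W}" for x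
      using that \<rho> g by auto
    define T where "T = (\<Sum>i\<in>UNIV. G (t, r) (axis i 1) $ i)"
    have P: "?P t r = - zeta0 hbar * zeta hbar m * T" unfolding T_def
      by (rule pressure_eq[of "{x. (t, x) \<in> W}" r \<rho> t "\<lambda>x. g (t, x)", OF slice _ near g(2)[OF tr]]) (use tr in auto)
    have div: "divergence (\<lambda>x. mass_density m \<rho> t x *\<^sub>R vel_u hbar m \<rho> t x) r = - m * zeta hbar m * T"
      unfolding T_def mass_density_def
      by (rule divergence_density_vel_u[of "{x. (t, x) \<in> W}" r \<rho> t "\<lambda>x. g (t, x)", OF slice _ near g(2)[OF tr]]) (use tr in auto)
    have "((\<lambda>s. (1 / m) *\<^sub>R k (s, r)) has_vector_derivative (1 / m) *\<^sub>R \<omega> (t, r)) (at t)"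
      using has_vector_derivative_scaleR[OF DERIV_const S(4)[OF tr], of "1 / m"] by simp
    then have "((\<lambda>s. vel_v m S s r) has_vector_derivative (1 / m) *\<^sub>R \<omega> (t, r)) (at t)"
      by (rule has_vector_derivative_transform_within_open[OF _ open_time_slice[OF W(1)]])
         (use tr grad_eq[OF S(2)] in \<open>auto simp: vel_v_def\<close>)
    \<comment> \<open>Since \<open>\<omega>\<close> is also the gradient of \<open>\<tau>\<close>,
      \<open>m\<close> times this derivative is \<open>- \<nabla>E\<close>.\<close>
    then have dtv: "dt (vel_v m S) t r = (1 / m) *\<^sub>R \<omega> (t, r)"
      unfolding dt_def by (rule vector_derivative_at)
    have gradients: "grad (N t) r = n (t, r)" "grad (?P t) r = p (t, r)" "grad (U t) r = u (t, r)"
      "grad (\<rho> t) r = g (t, r)"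
      using tr n(1) p(1) u(1) g(1) by (auto intro!: grad_eq)
    have vel_u_r: "vel_u hbar m \<rho> t r = - (zeta hbar m / \<rho> t r) *\<^sub>R g (t, r)"
      by (simp add: vel_u_def gradients)
    have euler: "mass_density m \<rho> t r *\<^sub>R dt (vel_v m S) t r
     + (1/2 * mass_density m \<rho> t r) *\<^sub>R grad (N t) r
     + grad (?P t) r
     + divergence (\<lambda>x. mass_density m \<rho> t x *\<^sub>R vel_u hbar m \<rho> t x) r *\<^sub>R vel_u hbar m \<rho> t r
     + \<rho> t r *\<^sub>R grad (U t) r = (- \<rho> t r) *\<^sub>R D (t, r)"
    proof -
      \<comment> \<open>Here \<open>y\<close> stands for \<open>P \<nabla>(1/\<rho>)\<close> and
        \<open>z\<close> for \<open>\<nabla>P/\<rho>\<close>, the two parts of the gradient of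
        \<open>P/\<rho>\<close>; they are interchanged to follow the order of the Euler
        equation.\<close>
      have expand: "(- a) *\<^sub>R (- w - (x + (y + z + q))) = a *\<^sub>R w + a *\<^sub>R x + a *\<^sub>R z + a *\<^sub>R y + a *\<^sub>R q"
        for a :: real and w x y z q :: "real^3"
        by (simp add: algebra_simps)
      have "mass_density m \<rho> t r *\<^sub>R (1 / m) *\<^sub>R \<omega> (t, r) = \<rho> t r *\<^sub>R \<omega> (t, r)"
        using \<open>m > 0\<close> by (simp add: mass_density_def)
      moreover have "(1/2 * mass_density m \<rho> t r) *\<^sub>R n (t, r) = \<rho> t r *\<^sub>R (m / 2) *\<^sub>R n (t, r)"
        by (simp add: mass_density_def)
      moreover have "p (t, r) = \<rho> t r *\<^sub>R inverse (\<rho> t r) *\<^sub>R p (t, r)"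
        using \<rho>[OF tr] by simp
      \<comment> \<open>Because \<open>m\<close> times \<open>zeta\<close> is \<open>zeta0\<close>,
        the divergence term of the Euler equation is \<open>\<rho>\<close> times
        \<open>P \<nabla>(1/\<rho>)\<close>.\<close>
      moreover have "(- m * zeta hbar m * T) *\<^sub>R (- (zeta hbar m / \<rho> t r) *\<^sub>R g (t, r))
          = \<rho> t r *\<^sub>R ?P t r *\<^sub>R (- (inverse (\<rho> t r))\<^sup>2 *\<^sub>R g (t, r))"
      proof -
        have "- m * zeta hbar m * T * - (zeta hbar m / \<rho> t r) = \<rho> t r * (?P t r * - (inverse (\<rho> t r))\<^sup>2)"
          unfolding P using \<rho>[OF tr] \<open>m > 0\<close> by (simp add: zeta_def power2_eq_square field_simps)
        then show ?thesis by (simp only: scaleR_scaleR)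
      qed
      ultimately show ?thesis
        unfolding dtv gradients div vel_u_r D_def prod.case expand by argo
    qed
    show "euler_equation hbar m U \<rho> S t r \<longleftrightarrow> D (t, r) = 0"
      unfolding euler_equation_def euler[unfolded N_def] using \<rho>[OF tr] by simp
  qed
qed

section \<open>The real part of the Schroedinger equation\<close>

lemma has_derivative_cexp:
  assumes "(f has_derivative D) (at x)"
  shows "((\<lambda>y. exp (f y :: complex)) has_derivative (\<lambda>h. D h * exp (f x))) (at x)"
  using has_derivative_compose[OF assms DERIV_exp[unfolded has_field_derivative_def]]
  by (simp add: mult.commute)

text \<open>Every derivative of the wave function is the wave function times a logarithmic factor.
  Multiplying by the conjugate turns the wave function into \<open>\<rho>\<close>, and only real
  parts of the factors remain. Positivity of \<open>\<rho>\<close> near \<open>r\<close> keeps the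
  square root differentiable.\<close>

lemma re_schroedinger_iff_energy:
  assumes "hbar > 0" "m > 0" "open X" "r \<in> X"
    and \<rho>: "\<And>x. x \<in> X \<Longrightarrow> \<rho> t x > 0"
    and g: "\<And>x. x \<in> X \<Longrightarrow> GDERIV (\<rho> t) x :> g x"
    and k: "\<And>x. x \<in> X \<Longrightarrow> GDERIV (S t) x :> k x"
    and G: "(g has_derivative G) (at r)" and K: "(k has_derivative K) (at r)"
    and dt_\<rho>: "((\<lambda>s. \<rho> s r) has_vector_derivative \<rho>') (at t)"
    and dt_S: "((\<lambda>s. S s r) has_vector_derivative S') (at t)"
  shows "re_schroedinger_equation hbar m U \<rho> S t r \<longleftrightarrow> energy_equation hbar m U \<rho> S t r"
proof -
  define \<psi> where "\<psi> = wave_function hbar \<rho> S"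
  \<comment> \<open>The logarithmic derivative of the wave function at \<open>x\<close> in direction
    \<open>h\<close>.\<close>
  define w :: "real^3 \<Rightarrow> real^3 \<Rightarrow> complex" where
    "w x h = of_real ((h \<bullet> g x) / (2 * \<rho> t x)) + \<i> * of_real ((h \<bullet> k x) / hbar)" for x h
  have r: "\<rho> t r > 0" using \<rho> \<open>r \<in> X\<close> .
  have d\<psi>: "(\<psi> t has_derivative (\<lambda>h. w x h * \<psi> t x)) (at x)" if "x \<in> X" for x
  proof -
    have sqrt: "((\<lambda>y. sqrt (\<rho> t y)) has_derivative (\<lambda>h. (h \<bullet> g x) * (inverse (sqrt (\<rho> t x)) / 2))) (at x)"
      using \<rho>[OF that] g[OF that, unfolded gderiv_def]
      by (intro has_derivative_real_sqrt)
    have phase: "((\<lambda>y. exp (\<i> * of_real (S t y / hbar))) has_derivative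
       (\<lambda>h. (\<i> * of_real ((h \<bullet> k x) / hbar)) * exp (\<i> * of_real (S t x / hbar)))) (at x)"
      using k[OF that, unfolded gderiv_def] \<open>hbar > 0\<close>
      by (intro has_derivative_cexp has_derivative_mult_right has_derivative_of_real)
         (auto intro!: derivative_eq_intros)
    \<comment> \<open>Rewritten so that the amplitude reappears as a factor, which makes the
      derivative a multiple of \<open>\<psi> t x\<close>.\<close>
    have "inverse (sqrt (\<rho> t x)) / 2 = sqrt (\<rho> t x) / (2 * \<rho> t x)"
      using \<rho>[OF that] real_div_sqrt[of "\<rho> t x"] by (simp add: field_simps)
    with sqrt have sqrt': "((\<lambda>y. sqrt (\<rho> t y)) has_derivative
        (\<lambda>h. (h \<bullet> g x) * (sqrt (\<rho> t x) / (2 * \<rho> t x)))) (at x)" by metis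
    show ?thesis
      unfolding \<psi>_def wave_function_def
      by (rule has_derivative_eq_rhs[OF has_derivative_mult[OF has_derivative_of_real[OF sqrt'] phase]])
         (simp add: w_def fun_eq_iff algebra_simps)
  qed
  have partial: "partial_deriv i (\<psi> t) x = w x (axis i 1) * \<psi> t x" if "x \<in> X" for i x
    by (simp add: partial_deriv_def frechet_derivative_at[OF d\<psi>[OF that], symmetric])
  \<comment> \<open>The derivative at \<open>r\<close> of \<open>w x (axis i 1)\<close> in direction
    \<open>axis i 1\<close>.\<close>
  define w' :: "3 \<Rightarrow> complex" where
    "w' i = of_real (G (axis i 1) $ i / (2 * \<rho> t r) - (g r $ i)\<^sup>2 / (2 * (\<rho> t r)\<^sup>2))
      + \<i> * of_real (K (axis i 1) $ i / hbar)" for i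
  have second: "partial_deriv i (partial_deriv i (\<psi> t)) r = (w' i + (w r (axis i 1))\<^sup>2) * \<psi> t r" for i
  proof -
    define e :: "real^3" where "e = axis i 1"
    have 1: "((\<lambda>x. (e \<bullet> g x) / (2 * \<rho> t x)) has_derivative
        (\<lambda>h. (e \<bullet> G h) / (2 * \<rho> t r) - (e \<bullet> g r) * (h \<bullet> g r) / (2 * (\<rho> t r)\<^sup>2))) (at r)"
      using r by (auto intro!: derivative_eq_intros G g[OF \<open>r \<in> X\<close>, unfolded gderiv_def]
          simp: power2_eq_square field_simps)
    have 2: "((\<lambda>x. (e \<bullet> k x) / hbar) has_derivative (\<lambda>h. (e \<bullet> K h) / hbar)) (at r)"
      using \<open>hbar > 0\<close> by (auto intro!: derivative_eq_intros K)
    have "((\<lambda>x. w x e) has_derivative (\<lambda>h. of_real ((e \<bullet> G h) / (2 * \<rho> t r)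
        - (e \<bullet> g r) * (h \<bullet> g r) / (2 * (\<rho> t r)\<^sup>2)) + \<i> * of_real ((e \<bullet> K h) / hbar))) (at r)"
      unfolding w_def
      by (intro has_derivative_add has_derivative_of_real 1 has_derivative_mult_right 2)
    from has_derivative_mult[OF this d\<psi>[OF \<open>r \<in> X\<close>]]
    have "((\<lambda>x. w x e * \<psi> t x) has_derivative
        (\<lambda>h. w r e * (w r h * \<psi> t r) + (of_real ((e \<bullet> G h) / (2 * \<rho> t r)
        - (e \<bullet> g r) * (h \<bullet> g r) / (2 * (\<rho> t r)\<^sup>2)) + \<i> * of_real ((e \<bullet> K h) / hbar)) * \<psi> t r)) (at r)" .
    then have "(partial_deriv i (\<psi> t) has_derivative
        (\<lambda>h. w r e * (w r h * \<psi> t r) + (of_real ((e \<bullet> G h) / (2 * \<rho> t r)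
        - (e \<bullet> g r) * (h \<bullet> g r) / (2 * (\<rho> t r)\<^sup>2)) + \<i> * of_real ((e \<bullet> K h) / hbar)) * \<psi> t r)) (at r)"
      by (rule has_derivative_transform_within_open[OF _ \<open>open X\<close> \<open>r \<in> X\<close>]) (simp add: partial e_def)
    from frechet_derivative_at[OF this, symmetric] show ?thesis
      by (simp add: partial_deriv_def[of i "partial_deriv i (\<psi> t)"] w'_def e_def inner_axis' 
          power2_eq_square algebra_simps)
  qed
  have norm_\<psi>: "cnj (\<psi> t r) * \<psi> t r = of_real (\<rho> t r)"
  proof -
    have "norm (\<psi> t r) = sqrt (\<rho> t r)"
      using r by (simp add: \<psi>_def wave_function_def norm_mult del: of_real_divide)
    then show ?thesis using r complex_norm_square[of "\<psi> t r"] by (simp add: mult.commute)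
  qed
  define A where "A = (\<Sum>i\<in>UNIV. (g r $ i)\<^sup>2)"
  define B where "B = (\<Sum>i\<in>UNIV. (k r $ i)\<^sup>2)"
  define T where "T = (\<Sum>i\<in>UNIV. G (axis i 1) $ i)"
  have norms: "(norm (g r))\<^sup>2 = A" "(norm (k r))\<^sup>2 = B"
    unfolding A_def B_def power2_norm_eq_inner inner_vec_def by (simp_all add: power2_eq_square)
  have "Re (cnj (\<psi> t r) * laplacian (\<psi> t) r)
      = Re ((\<Sum>i\<in>UNIV. w' i + (w r (axis i 1))\<^sup>2) * (cnj (\<psi> t r) * \<psi> t r))"
    unfolding laplacian_def second sum_distrib_right[symmetric] by (simp only: mult_ac)
  also have "\<dots> = \<rho> t r * (\<Sum>i\<in>UNIV. Re (w' i) + Re ((w r (axis i 1))\<^sup>2))"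
    unfolding norm_\<psi> by (simp add: mult.commute)
  \<comment> \<open>The squared real part of \<open>w\<close> raises the coefficient of
    \<open>(g r $ i)\<^sup>2 / (\<rho> t r)\<^sup>2\<close> from -1/2 to -1/4; the squared imaginary
    part gives the term in \<open>k\<close>.\<close>
  also have "\<dots> = \<rho> t r * (\<Sum>i\<in>UNIV. (1 / (2 * \<rho> t r)) * G (axis i 1) $ i - (1 / (4 * (\<rho> t r)\<^sup>2)) * (g r $ i)\<^sup>2
      - (1 / hbar\<^sup>2) * (k r $ i)\<^sup>2)"
    by (intro arg_cong2[where f = "(*)"] refl sum.cong)
       (simp add: w_def w'_def inner_axis' power2_eq_square field_simps)
  also have "\<dots> = \<rho> t r * (T / (2 * \<rho> t r) - A / (4 * (\<rho> t r)\<^sup>2) - B / hbar\<^sup>2)"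
    by (simp only: sum_subtractf sum_distrib_left[symmetric] A_def B_def T_def) simp
  finally have laplace: "Re (cnj (\<psi> t r) * laplacian (\<psi> t) r)
      = \<rho> t r * (T / (2 * \<rho> t r) - A / (4 * (\<rho> t r)\<^sup>2) - B / hbar\<^sup>2)" .
  have "((\<lambda>s. \<psi> s r) has_vector_derivative (of_real (\<rho>' / (2 * \<rho> t r)) + \<i> * of_real (S' / hbar)) * \<psi> t r) (at t)"
  proof -
    have "inverse (sqrt (\<rho> t r)) / 2 = sqrt (\<rho> t r) / (2 * \<rho> t r)"
      using r real_div_sqrt[of "\<rho> t r"] by (simp add: field_simps)
    moreover have "((\<lambda>s. sqrt (\<rho> s r)) has_derivative (\<lambda>h. (h *\<^sub>R \<rho>') * (inverse (sqrt (\<rho> t r)) / 2))) (at t)"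
      using r dt_\<rho>[unfolded has_vector_derivative_def] by (intro has_derivative_real_sqrt)
    ultimately have sqrt: "((\<lambda>s. sqrt (\<rho> s r)) has_derivative
        (\<lambda>h. (h *\<^sub>R \<rho>') * (sqrt (\<rho> t r) / (2 * \<rho> t r)))) (at t)" by metis
    have phase: "((\<lambda>s. exp (\<i> * of_real (S s r / hbar))) has_derivative
       (\<lambda>h. (\<i> * of_real ((h *\<^sub>R S') / hbar)) * exp (\<i> * of_real (S t r / hbar)))) (at t)"
      using dt_S[unfolded has_vector_derivative_def] \<open>hbar > 0\<close>
      by (intro has_derivative_cexp has_derivative_mult_right has_derivative_of_real)
         (auto intro!: derivative_eq_intros)
    show ?thesis
      unfolding \<psi>_def wave_function_def has_vector_derivative_def
      by (rule has_derivative_eq_rhs[OF has_derivative_mult[OF has_derivative_of_real[OF sqrt] phase]])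
         (simp add: fun_eq_iff scaleR_conv_of_real algebra_simps)
  qed
  then have dt_\<psi>: "dt \<psi> t r = (of_real (\<rho>' / (2 * \<rho> t r)) + \<i> * of_real (S' / hbar)) * \<psi> t r"
    unfolding dt_def by (rule vector_derivative_at)
  have "Re (\<i> * of_real hbar * cnj (\<psi> t r) * dt \<psi> t r)
      = Re (\<i> * of_real hbar * (of_real (\<rho>' / (2 * \<rho> t r)) + \<i> * of_real (S' / hbar)) * (cnj (\<psi> t r) * \<psi> t r))"
    by (simp only: dt_\<psi> mult_ac)
  \<comment> \<open>The amplitude term in \<open>\<rho>'\<close> becomes purely imaginary and drops
    out.\<close>
  also have "\<dots> = - S' * \<rho> t r"
    unfolding norm_\<psi> using \<open>hbar > 0\<close> by simp
  finally have lhs: "Re (\<i> * of_real hbar * cnj (\<psi> t r) * dt \<psi> t r) = - S' * \<rho> t r" .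
  have "cnj (\<psi> t r) * hamiltonian hbar m U \<psi> t r
      = of_real (- (hbar\<^sup>2 / (2 * m))) * (cnj (\<psi> t r) * laplacian (\<psi> t) r)
        + of_real (U t r) * (cnj (\<psi> t r) * \<psi> t r)"
    by (simp add: hamiltonian_def algebra_simps)
  then have rhs: "Re (cnj (\<psi> t r) * hamiltonian hbar m U \<psi> t r)
      = - (hbar\<^sup>2 / (2 * m)) * (\<rho> t r * (T / (2 * \<rho> t r) - A / (4 * (\<rho> t r)\<^sup>2) - B / hbar\<^sup>2)) + U t r * \<rho> t r"
    by (simp only: norm_\<psi> laplace[symmetric]) simp
  have P: "pressure hbar m \<rho> t r = - zeta0 hbar * zeta hbar m * T"
    unfolding T_def by (rule pressure_eq[of X r \<rho> t g, OF assms(3,4) _ g G]) (use \<rho> in force)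
  have E: "energy S t r = - S'"
    using vector_derivative_at[OF dt_S] by (simp add: energy_def dt_def)
  \<comment> \<open>The terms in \<open>T\<close>, \<open>A\<close> and \<open>B\<close> become the
    pressure, the \<open>u\<close> part and the \<open>v\<close> part of the kinetic energy,
    respectively.\<close>
  have "- (hbar\<^sup>2 / (2 * m)) * (\<rho> t r * (T / (2 * \<rho> t r) - A / (4 * (\<rho> t r)\<^sup>2) - B / hbar\<^sup>2))
    = 1/2 * mass_density m \<rho> t r * (norm (vel_u hbar m \<rho> t r))\<^sup>2
       + 1/2 * mass_density m \<rho> t r * (norm (vel_v m S t r))\<^sup>2 + pressure hbar m \<rho> t r"
    unfolding P vel_u_def vel_v_def grad_eq[OF g[OF \<open>r \<in> X\<close>]] grad_eq[OF k[OF \<open>r \<in> X\<close>]]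
      mass_density_def zeta_def zeta0_def norm_scaleR power_mult_distrib norms
    using r \<open>hbar > 0\<close> \<open>m > 0\<close> by (simp add: field_simps power2_eq_square)
  then show ?thesis
    unfolding re_schroedinger_equation_def energy_equation_def Let_def \<psi>_def[symmetric] lhs rhs E by simp
qed

section \<open>Equivalence almost everywhere\<close>

lemma regular_on_subset:
  assumes "regular_on hbar m U \<rho> S W" "V \<subseteq> W" "open V"
  shows "regular_on hbar m U \<rho> S V"
proof -
  have C1: "C1_on V f" if "C1_on W f" for f :: "real \<times> (real^3) \<Rightarrow> (real \<times> (real^3)) \<Rightarrow>\<^sub>L real"
    using that \<open>V \<subseteq> W\<close> unfolding C1_on_def by (meson continuous_on_subset subsetD)
  have C2: "C2_on V f" if f: "C2_on W f" for f :: "real \<times> (real^3) \<Rightarrow> real"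
  proof -
    obtain f' where "\<forall>z\<in>W. (f has_derivative blinfun_apply (f' z)) (at z)" "C1_on W f'"
      using f unfolding C2_on_def by blast
    then show ?thesis
      unfolding C2_on_def using C1[of f'] \<open>V \<subseteq> W\<close> by (intro exI[of _ f']) auto
  qed
  have sp: "space_C1_on V f" if "space_C1_on W f" for f
    using that \<open>V \<subseteq> W\<close> unfolding space_C1_on_def by (meson continuous_on_subset subsetD)
  show ?thesis using assms C2 sp by (simp add: regular_on_def)
qed

text \<open>The zeros of \<open>\<rho>\<close> are null at each single time; integrating over time
  makes them null in space-time within the regular set, and continuity of \<open>\<rho>\<close>
  keeps the remaining set open.\<close>

lemma AE_regular_nonzero:
  assumes reg: "regular_on hbar m U \<rho> S \<Omega>" and ae: "AE z in lborel. z \<in> \<Omega>"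
    and zeros: "\<And>t. AE r in lborel. \<rho> t r \<noteq> 0"
  obtains V where "regular_on hbar m U \<rho> S V" "\<And>t r. (t, r) \<in> V \<Longrightarrow> \<rho> t r \<noteq> 0" "AE z in lborel. z \<in> V"
proof -
  define V where "V = {z \<in> \<Omega>. (case z of (t, r) \<Rightarrow> \<rho> t r) \<noteq> 0}"
  have \<Omega>: "open \<Omega>" "C2_on \<Omega> (\<lambda>(t, r). \<rho> t r)" using reg by (auto simp: regular_on_def)
  then have "continuous_on \<Omega> (\<lambda>(t, r). \<rho> t r)"
    using C2_on_field by metis
  then have "open ((\<lambda>(t, r). \<rho> t r) -` (- {0}) \<inter> \<Omega>)"
    using \<Omega>(1) by (subst (asm) continuous_on_open_vimage) auto
  moreover have "V = (\<lambda>(t, r). \<rho> t r) -` (- {0}) \<inter> \<Omega>" by (auto simp: V_def)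
  ultimately have "open V" by simp
  have "AE z in lborel \<Otimes>\<^sub>M lborel. z \<in> \<Omega> \<longrightarrow> z \<in> V"
  proof (rule lborel_pair.AE_pair_measure)
    \<comment> \<open>The passage from slices to the product measure needs a measurable set; this
      one is a union of a closed and an open set.\<close>
    have "- \<Omega> \<union> V \<in> sets borel"
      using \<open>open \<Omega>\<close> \<open>open V\<close> by (intro sets.Un borel_closed borel_open) (auto simp: closed_def)
    moreover have "{z. z \<in> \<Omega> \<longrightarrow> z \<in> V} = - \<Omega> \<union> V" by auto
    ultimately show "{z \<in> space (lborel \<Otimes>\<^sub>M lborel). z \<in> \<Omega> \<longrightarrow> z \<in> V} \<in> sets (lborel \<Otimes>\<^sub>M lborel)"
      unfolding lborel_prod by simp
    show "AE t in lborel. AE r in lborel. (t, r) \<in> \<Omega> \<longrightarrow> (t, r) \<in> V"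
    proof (rule AE_I2)
      show "AE r in lborel. (t, r) \<in> \<Omega> \<longrightarrow> (t, r) \<in> V" for t
        using zeros[of t] by eventually_elim (simp add: V_def)
    qed
  qed
  then have "AE z in lborel. z \<in> V"
    using ae unfolding lborel_prod by eventually_elim blast
  show thesis
  proof (rule that)
    show "regular_on hbar m U \<rho> S V"
      by (rule regular_on_subset[OF reg _ \<open>open V\<close>]) (auto simp: V_def)
    show "\<rho> t r \<noteq> 0" if "(t, r) \<in> V" for t r using that by (simp add: V_def)
  qed fact
qed

section \<open>From the Euler equation to a phase, and back\<close>

text \<open>The gradient of the residual vanishes everywhere on \<open>W\<close> by continuity, so
  connectedness of the spatial sections makes the residual a function \<open>c\<close> of time. Its
  antiderivative \<open>\<theta>\<close> is the phase that restores the energy equation.\<close>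

lemma euler_imp_residual_time_dependent:
  assumes "hbar > 0" "m > 0" and W: "phase_region hbar m U \<rho> S W"
    and euler: "holds_ae (euler_equation hbar m U \<rho> S)"
  obtains \<theta> c where "continuous_on (fst ` W) c"
    "\<And>t. t \<in> fst ` W \<Longrightarrow> (\<theta> has_vector_derivative c t) (at t)"
    "\<And>t r. (t, r) \<in> W \<Longrightarrow> residual hbar m U \<rho> S t r = c t"
proof -
  let ?R = "residual hbar m U \<rho> S"
  have reg: "regular_on hbar m U \<rho> S W" and \<rho>: "\<And>t r. (t, r) \<in> W \<Longrightarrow> \<rho> t r \<noteq> 0"
    and conn: "\<And>t. connected {r. (t, r) \<in> W}"
    using W by (auto simp: phase_region_def)
  have "open W" using reg by (simp add: regular_on_def)
  obtain D where D: "continuous_on W (\<lambda>(t, r). ?R t r)" "continuous_on W D"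
    "\<And>t r. (t, r) \<in> W \<Longrightarrow> GDERIV (?R t) r :> D (t, r)"
    "\<And>t r. (t, r) \<in> W \<Longrightarrow> euler_equation hbar m U \<rho> S t r \<longleftrightarrow> D (t, r) = 0"
    using residual_gradient[OF \<open>m > 0\<close> \<open>hbar > 0\<close> reg \<rho>] by metis
  have "AE z in lborel. z \<in> W \<longrightarrow> D z = 0"
    using euler unfolding holds_ae_def by eventually_elim (use D(4) in auto)
  then have D0: "D z = 0" if "z \<in> W" for z
    using open_AE_zero_imp_zero[OF \<open>open W\<close> D(2) _ that] by blast
  have const: "?R t x = ?R t y" if "(t, x) \<in> W" "(t, y) \<in> W" for t x y
  proof (rule has_derivative_zero_unique_connected[OF open_space_slice[OF \<open>open W\<close>] conn])
    fix r assume "r \<in> {r. (t, r) \<in> W}"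
    then show "(?R t has_derivative (\<lambda>x. 0)) (at r)"
      using D(3)[of t r] D0[of "(t, r)"] by (simp add: gderiv_def)
  qed (use that in auto)
  define c where "c t = ?R t (SOME r. (t, r) \<in> W)" for t
  have c: "?R t r = c t" if "(t, r) \<in> W" for t r
    unfolding c_def using that by (rule const) (rule someI[of "\<lambda>r. (t, r) \<in> W", OF that])
  have "isCont c t" if t: "t \<in> fst ` W" for t
  proof -
    obtain r where "(t, r) \<in> W" using t by auto
    \<comment> \<open>Continuity of \<open>c\<close> at \<open>t\<close> is checked along a fixed
      position \<open>r\<close>: for \<open>s\<close> near \<open>t\<close> the point
      \<open>(s, r)\<close> stays in \<open>W\<close>, where \<open>c s\<close> is the
      residual.\<close>
    let ?T = "{s. (s, r) \<in> W}"
    have "continuous_on ?T (\<lambda>s. (\<lambda>(t, r). ?R t r) (s, r))"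
      by (rule continuous_on_compose2[OF D(1)]) (auto intro!: continuous_intros)
    then have "continuous_on ?T c" by (rule continuous_on_eq) (use c in auto)
    then show ?thesis
      using open_time_slice[OF \<open>open W\<close>, of r] \<open>(t, r) \<in> W\<close> by (simp add: continuous_on_eq_continuous_at)
  qed
  then have cont: "continuous_on (fst ` W) c" by (simp add: continuous_at_imp_continuous_on)
  moreover obtain \<theta> where "\<And>t. t \<in> fst ` W \<Longrightarrow> (\<theta> has_vector_derivative c t) (at t)"
    using antiderivative_open_real[OF open_image_fst[OF \<open>open W\<close>] cont] by metis
  ultimately show thesis using c that by blast
qed

lemma energy_equation_add_phase:
  assumes "regular_on hbar m U \<rho> S W" "(t, r) \<in> W" "\<rho> t r \<noteq> 0" "(\<theta> has_vector_derivative c) (at t)"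
  shows "energy_equation hbar m U \<rho> (\<lambda>t r. S t r + \<theta> t) t r \<longleftrightarrow> residual hbar m U \<rho> S t r = c"
proof -
  have W: "open W" "C2_on W (\<lambda>(t, r). S t r)" using assms(1) by (auto simp: regular_on_def)
  obtain \<tau> where "\<And>t r. (t, r) \<in> W \<Longrightarrow> ((\<lambda>s. S s r) has_vector_derivative \<tau> (t, r)) (at t)"
    using C2_on_field[OF W] by metis
  from residual_add_phase[of S r, OF this[OF assms(2)] assms(4)] show ?thesis
    by (simp add: energy_equation_iff_residual[of \<rho> t r, OF assms(3)])
qed

text \<open>The Euler equation is local, so a small phase region around the given point suffices:
  there the residual equals the derivative of some phase, a function of time, and its spatial
  gradient vanishes.\<close>

lemma energy_within_phase_imp_euler:
  assumes "hbar > 0" "m > 0" and reg: "regular_on hbar m U \<rho> S V"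
    and \<rho>: "\<And>t r. (t, r) \<in> V \<Longrightarrow> \<rho> t r \<noteq> 0"
    and energy: "holds_ae_within_phase hbar m U \<rho> S (energy_equation hbar m U \<rho>)"
    and "(t\<^sub>0, r\<^sub>0) \<in> V"
  shows "euler_equation hbar m U \<rho> S t\<^sub>0 r\<^sub>0"
proof -
  let ?R = "residual hbar m U \<rho> S"
  have "open V" using reg by (simp add: regular_on_def)
  then obtain A B where AB: "open A" "open B" "t\<^sub>0 \<in> A" "r\<^sub>0 \<in> B" "A \<times> B \<subseteq> V"
    using \<open>(t\<^sub>0, r\<^sub>0) \<in> V\<close> open_prod_elim by (metis mem_Sigma_iff)
  obtain e where e: "e > 0" "ball r\<^sub>0 e \<subseteq> B" using AB by (meson openE)
  \<comment> \<open>A ball as spatial factor makes every section connected: it is the ball or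
    empty.\<close>
  define W where "W = A \<times> ball r\<^sub>0 e"
  have W: "open W" "W \<subseteq> V" "(t\<^sub>0, r\<^sub>0) \<in> W" using AB e by (auto simp: W_def intro: open_Times)
  have regW: "regular_on hbar m U \<rho> S W" using regular_on_subset[OF reg W(2,1)] .
  have \<rho>W: "\<rho> t r \<noteq> 0" if "(t, r) \<in> W" for t r using that \<rho> W(2) by blast
  have "connected {r. (t, r) \<in> W}" for t
    by (cases "t \<in> A") (auto simp: W_def simp del: mem_ball)
  then have "phase_region hbar m U \<rho> S W"
    using regW \<rho>W by (auto simp: phase_region_def)
  then obtain \<theta> where "\<theta> C1_differentiable_on (fst ` W)"
    and ae: "holds_ae (\<lambda>t r. (t, r) \<in> W \<longrightarrow> energy_equation hbar m U \<rho> (\<lambda>t r. S t r + \<theta> t) t r)"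
    using energy unfolding holds_ae_within_phase_def by blast
  then obtain c where c: "\<And>t. t \<in> fst ` W \<Longrightarrow> (\<theta> has_vector_derivative c t) (at t)"
    "continuous_on (fst ` W) c"
    unfolding C1_differentiable_on_def by blast
  obtain D where D: "continuous_on W (\<lambda>(t, r). ?R t r)"
    "\<And>t r. (t, r) \<in> W \<Longrightarrow> GDERIV (?R t) r :> D (t, r)"
    "\<And>t r. (t, r) \<in> W \<Longrightarrow> euler_equation hbar m U \<rho> S t r \<longleftrightarrow> D (t, r) = 0"
    using residual_gradient[OF \<open>m > 0\<close> \<open>hbar > 0\<close> regW \<rho>W] by metis
  have iff: "energy_equation hbar m U \<rho> (\<lambda>t r. S t r + \<theta> t) t r \<longleftrightarrow> ?R t r = c t" if "(t, r) \<in> W" for t r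
    by (rule energy_equation_add_phase[OF regW that \<rho>W[OF that]]) (use c(1) that in force)
  \<comment> \<open>The C1 condition on \<open>\<theta>\<close> enters here: continuity of
    \<open>c\<close> allows \<open>q = 0\<close> to pass from almost everywhere to all of
    \<open>W\<close>.\<close>
  define q where "q z = (case z of (t, r) \<Rightarrow> ?R t r) - c (fst z)" for z
  have "continuous_on W q" unfolding q_def
    by (intro continuous_on_diff D(1) continuous_on_compose2[OF c(2)] continuous_on_fst continuous_on_id) auto
  moreover have "AE z in lborel. z \<in> W \<longrightarrow> q z = 0"
    using ae unfolding holds_ae_def by eventually_elim (use iff in \<open>auto simp: q_def\<close>)
  ultimately have "q z = 0" if "z \<in> W" for z
    using open_AE_zero_imp_zero[OF \<open>open W\<close>] that by blast
  then have R: "?R t r = c t" if "(t, r) \<in> W" for t r using that by (force simp: q_def)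
  have "GDERIV (?R t\<^sub>0) r\<^sub>0 :> 0"
    by (rule GDERIV_transform[OF GDERIV_const open_space_slice[OF W(1)]]) (use W(3) R in auto)
  then have "D (t\<^sub>0, r\<^sub>0) = 0" using D(2)[OF W(3)] GDERIV_unique by blast
  then show ?thesis using D(3)[OF W(3)] by simp
qed

section \<open>Transfer to the Schroedinger equation\<close>

text \<open>The phase preserves the spatial derivatives of \<open>S\<close> and adds
  \<open>c\<close> to its time derivative, so the pointwise equivalence applies to the shifted phase
  as well.\<close>

lemma re_schroedinger_add_phase_iff_energy:
  assumes "hbar > 0" "m > 0" and nonneg: "\<And>t r. \<rho> t r \<ge> 0"
    and reg: "regular_on hbar m U \<rho> S W" and \<rho>: "\<And>t r. (t, r) \<in> W \<Longrightarrow> \<rho> t r \<noteq> 0" and "(t, r) \<in> W"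
    and \<theta>: "(\<theta> has_vector_derivative c) (at t)"
  shows "re_schroedinger_equation hbar m U \<rho> (\<lambda>t r. S t r + \<theta> t) t r \<longleftrightarrow>
    energy_equation hbar m U \<rho> (\<lambda>t r. S t r + \<theta> t) t r"
proof -
  have W: "open W" "C2_on W (\<lambda>(t, r). \<rho> t r)" "C2_on W (\<lambda>(t, r). S t r)"
    using reg by (auto simp: regular_on_def)
  obtain \<rho>' g G where g: "\<And>t r. (t, r) \<in> W \<Longrightarrow> ((\<lambda>s. \<rho> s r) has_vector_derivative \<rho>' (t, r)) (at t)"
    "\<And>t r. (t, r) \<in> W \<Longrightarrow> GDERIV (\<rho> t) r :> g (t, r)"
    "\<And>t r. (t, r) \<in> W \<Longrightarrow> ((\<lambda>x. g (t, x)) has_derivative G (t, r)) (at r)"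
    using C2_on_field[OF W(1,2)] by metis
  obtain \<tau> k K where k: "\<And>t r. (t, r) \<in> W \<Longrightarrow> ((\<lambda>s. S s r) has_vector_derivative \<tau> (t, r)) (at t)"
    "\<And>t r. (t, r) \<in> W \<Longrightarrow> GDERIV (S t) r :> k (t, r)"
    "\<And>t r. (t, r) \<in> W \<Longrightarrow> ((\<lambda>x. k (t, x)) has_derivative K (t, r)) (at r)"
    using C2_on_field[OF W(1,3)] by metis
  show ?thesis
  proof (rule re_schroedinger_iff_energy[OF assms(1,2) open_space_slice[OF W(1)]])
    show "r \<in> {x. (t, x) \<in> W}" using \<open>(t, r) \<in> W\<close> by simp
    show "\<rho> t x > 0" if "x \<in> {x. (t, x) \<in> W}" for x
      using that nonneg[of t x] \<rho>[of t x] by simp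
    show "GDERIV (\<rho> t) x :> g (t, x)" if "x \<in> {x. (t, x) \<in> W}" for x using that g(2) by simp
    show "GDERIV (\<lambda>r. S t r + \<theta> t) x :> k (t, x)" if "x \<in> {x. (t, x) \<in> W}" for x
      using GDERIV_add[OF k(2) GDERIV_const, of t x "\<theta> t"] that by simp
    show "((\<lambda>x. g (t, x)) has_derivative G (t, r)) (at r)" "((\<lambda>x. k (t, x)) has_derivative K (t, r)) (at r)"
      "((\<lambda>s. \<rho> s r) has_vector_derivative \<rho>' (t, r)) (at t)"
      using g(1,3) k(3) \<open>(t, r) \<in> W\<close> by blast+
    show "((\<lambda>s. S s r + \<theta> s) has_vector_derivative \<tau> (t, r) + c) (at t)"
      using k(1)[OF \<open>(t, r) \<in> W\<close>] \<theta> by (rule has_vector_derivative_add)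
  qed
qed

text \<open>On each region the same \<open>\<theta>\<close> serves both equations, because they
  agree pointwise for every admissible \<open>\<theta>\<close>.\<close>

lemma holds_ae_within_phase_schroedinger_iff_energy:
  assumes "hbar > 0" "m > 0" "\<And>t r. \<rho> t r \<ge> 0"
  shows "holds_ae_within_phase hbar m U \<rho> S (re_schroedinger_equation hbar m U \<rho>) \<longleftrightarrow>
    holds_ae_within_phase hbar m U \<rho> S (energy_equation hbar m U \<rho>)"
proof -
  have eq: "((t, r) \<in> W \<longrightarrow> re_schroedinger_equation hbar m U \<rho> (\<lambda>t r. S t r + \<theta> t) t r) \<longleftrightarrow>
      ((t, r) \<in> W \<longrightarrow> energy_equation hbar m U \<rho> (\<lambda>t r. S t r + \<theta> t) t r)"
    if W: "phase_region hbar m U \<rho> S W" and \<theta>: "\<theta> C1_differentiable_on (fst ` W)" for W \<theta> t r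
  proof (intro imp_cong refl)
    assume tr: "(t, r) \<in> W"
    then obtain c where c: "(\<theta> has_vector_derivative c) (at t)"
      using \<theta> unfolding C1_differentiable_on_def by force
    show "re_schroedinger_equation hbar m U \<rho> (\<lambda>t r. S t r + \<theta> t) t r \<longleftrightarrow>
        energy_equation hbar m U \<rho> (\<lambda>t r. S t r + \<theta> t) t r"
      by (rule re_schroedinger_add_phase_iff_energy[OF assms _ _ tr c])
         (use W in \<open>auto simp: phase_region_def\<close>)
  qed
  have "holds_ae (\<lambda>t r. (t, r) \<in> W \<longrightarrow> re_schroedinger_equation hbar m U \<rho> (\<lambda>t r. S t r + \<theta> t) t r) \<longleftrightarrow>
      holds_ae (\<lambda>t r. (t, r) \<in> W \<longrightarrow> energy_equation hbar m U \<rho> (\<lambda>t r. S t r + \<theta> t) t r)"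
    if "phase_region hbar m U \<rho> S W" "\<theta> C1_differentiable_on (fst ` W)" for W \<theta>
    by (intro arg_cong[of _ _ holds_ae] ext eq[OF that])
  then show ?thesis unfolding holds_ae_within_phase_def
    by (intro all_cong1 imp_cong ex_cong1 conj_cong refl)
qed

text \<open>The zero phase is admissible on every region.\<close>

lemma holds_ae_imp_within_phase:
  assumes "holds_ae (eqn S)"
  shows "holds_ae_within_phase hbar m U \<rho> S eqn"
  unfolding holds_ae_within_phase_def
proof (intro allI impI exI[of _ "\<lambda>_. 0"] conjI)
  show "(\<lambda>_. 0 :: real) C1_differentiable_on (fst ` W)" for W :: "(real \<times> (real^3)) set"
    unfolding C1_differentiable_on_def
    by (rule exI[of _ "\<lambda>_. 0"]) (simp add: has_vector_derivative_const)
  show "holds_ae (\<lambda>t r. (t, r) \<in> W \<longrightarrow> eqn (\<lambda>t r. S t r + 0) t r)" for W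
    using assms unfolding holds_ae_def by (auto elim: eventually_mono)
qed

text \<open>The equivalences allow a phase on each region; the second and fourth conjuncts concern
  the given \<open>S\<close> itself and follow by taking the zero phase.\<close>

theorem theorem5:
  fixes hbar m :: real and \<rho> S U :: "real field"
  assumes "hbar > 0" and "m > 0"
    and nonneg: "\<And>t r. \<rho> t r \<ge> 0"
    and zeros: "\<And>t. AE r in lborel. \<rho> t r \<noteq> 0"
    and normalized: "\<And>t. (\<rho> t has_integral 1) UNIV"
    and regular: "\<exists>\<Omega>. regular_on hbar m U \<rho> S \<Omega> \<and> (AE z in lborel. z \<in> \<Omega>)"
  shows "(holds_ae (euler_equation hbar m U \<rho> S) \<longleftrightarrow>
            holds_ae_within_phase hbar m U \<rho> S (energy_equation hbar m U \<rho>)) \<and>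
         (holds_ae (energy_equation hbar m U \<rho> S) \<longrightarrow>
            holds_ae (euler_equation hbar m U \<rho> S)) \<and>
         (holds_ae (euler_equation hbar m U \<rho> S) \<longleftrightarrow>
            holds_ae_within_phase hbar m U \<rho> S (re_schroedinger_equation hbar m U \<rho>)) \<and>
         (holds_ae (re_schroedinger_equation hbar m U \<rho> S) \<longrightarrow>
            holds_ae (euler_equation hbar m U \<rho> S))"
proof -
  obtain V where V: "regular_on hbar m U \<rho> S V" "\<And>t r. (t, r) \<in> V \<Longrightarrow> \<rho> t r \<noteq> 0" "AE z in lborel. z \<in> V"
    using regular AE_regular_nonzero zeros by metis
  have "holds_ae (euler_equation hbar m U \<rho> S) \<longleftrightarrow>
      holds_ae_within_phase hbar m U \<rho> S (energy_equation hbar m U \<rho>)"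
  proof
    assume euler: "holds_ae (euler_equation hbar m U \<rho> S)"
    show "holds_ae_within_phase hbar m U \<rho> S (energy_equation hbar m U \<rho>)"
      unfolding holds_ae_within_phase_def
    proof (intro allI impI)
      fix W assume W: "phase_region hbar m U \<rho> S W"
      obtain \<theta> c where \<theta>: "continuous_on (fst ` W) c"
        "\<And>t. t \<in> fst ` W \<Longrightarrow> (\<theta> has_vector_derivative c t) (at t)"
        "\<And>t r. (t, r) \<in> W \<Longrightarrow> residual hbar m U \<rho> S t r = c t"
        using euler_imp_residual_time_dependent[OF assms(1,2) W euler] by metis
      have "energy_equation hbar m U \<rho> (\<lambda>t r. S t r + \<theta> t) t r" if "(t, r) \<in> W" for t r
        using energy_equation_add_phase[of hbar m U \<rho> S W t r \<theta> "c t"] W that \<theta>(2)[of t] \<theta>(3)[of t r]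
        by (force simp: phase_region_def)
      then have "holds_ae (\<lambda>t r. (t, r) \<in> W \<longrightarrow> energy_equation hbar m U \<rho> (\<lambda>t r. S t r + \<theta> t) t r)"
        by (simp add: holds_ae_def)
      moreover have "\<theta> C1_differentiable_on (fst ` W)"
        using \<theta> unfolding C1_differentiable_on_def by blast
      ultimately show "\<exists>\<theta>. \<theta> C1_differentiable_on (fst ` W) \<and>
          holds_ae (\<lambda>t r. (t, r) \<in> W \<longrightarrow> energy_equation hbar m U \<rho> (\<lambda>t r. S t r + \<theta> t) t r)"
        by blast
    qed
  next
    assume "holds_ae_within_phase hbar m U \<rho> S (energy_equation hbar m U \<rho>)"
    \<comment> \<open>The sections of \<open>V\<close> may be disconnected; the lemma applied here
      works around one point at a time.\<close>
    then have "euler_equation hbar m U \<rho> S t r" if "(t, r) \<in> V" for t r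
      using energy_within_phase_imp_euler[OF assms(1,2) V(1,2)] that by blast
    then show "holds_ae (euler_equation hbar m U \<rho> S)"
      unfolding holds_ae_def using V(3) by (auto elim: eventually_mono)
  qed
  then show ?thesis
    using holds_ae_within_phase_schroedinger_iff_energy[of hbar m \<rho> U S, OF assms(1,2) nonneg]
      holds_ae_imp_within_phase[of "energy_equation hbar m U \<rho>" S hbar m U \<rho>]
      holds_ae_imp_within_phase[of "re_schroedinger_equation hbar m U \<rho>" S hbar m U \<rho>] by blast
qed

end
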